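(* Let $d,N\geq 1$ and denote the open unit ball of $M_d(\mathbb{R})$ by $\mathbf{B}_d$. For each $A_1,\ldots,A_N\in\mathbf{B}_d$ define \[\mathfrak{s}(A_1,\ldots,A_N):=\inf\left\{s>0 : \lim_{n\to\infty}\frac1n\log\sum_{i_1,\ldots,i_n=1}^N\varphi^s(A_{i_1}\cdots A_{i_n})<0\right\}\in[0,+\infty).\] Then $\mathfrak{s}\colon\mathbf{B}_d^N\to[0,+\infty)$ is continuous.
   Context: $M_d(\mathbb{R})$ is the space of real $d\times d$ matrices with the operator norm $\|\cdot\|$ induced by the Euclidean norm, so $\mathbf{B}_d=\{A:\|A\|<1\}$; $\sigma_1(A)\geq\cdots\geq\sigma_d(A)$ are the singular values of $A$. For $s>0$ and $A\in M_d(\mathbb{R})$, $\varphi^s(A):=\sigma_1(A)\cdots\sigma_k(A)\sigma_{k+1}(A)^{s-k}$ if $k\leq s\leq k+1\leq d$ with $k\geq0$ an integer (with $0^0:=1$), and $\varphi^s(A):=|\det A|^{s/d}$ if $s\geq d$. The limit in the definition exists in $[-\infty,+\infty)$ by subadditivity (since $\varphi^s(AB)\leq\varphi^s(A)\varphi^s(B)$), with $\log0:=-\infty$. *)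

theory Defs
  imports "HOL-Analysis.Analysis" "HOL-Computational_Algebra.Polynomial"
begin

text \<open>
  Matrices in $M_d(R)$ have type \<open>real^'d^'d\<close> with $d$ = \<open>CARD('d)\<close>, and tuples
  $(A_1,\dots,A_N)$ have type \<open>real^'d^'d^'N\<close> with $N$ = \<open>CARD('N)\<close>.  The library norm on
  \<open>real^'d^'d\<close> is the Frobenius norm, so the open unit ball is defined explicitly through the
  Euclidean operator norm.  Both norms induce the same topology.
\<close>

definition op_unit_ball :: "(real^'d^'d) set" where
  "op_unit_ball = {A. onorm ((*v) A) < 1}"

definition charpoly :: "real^'d^'d \<Rightarrow> real poly" where
  "charpoly A = det (mat [:0, 1:] - map_matrix (\<lambda>x. [:x:]) A)"

text \<open>
  The singular values are the square roots of the eigenvalues of $A^T A$, counted with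
  multiplicity and listed in decreasing order.
\<close>

definition singular_values :: "real^'d^'d \<Rightarrow> real list" where
  "singular_values A =
     rev (sorted_list_of_multiset (image_mset sqrt (proots (charpoly (transpose A ** A)))))"

definition singular_value :: "nat \<Rightarrow> real^'d^'d \<Rightarrow> real" where
  "singular_value k A = singular_values A ! (k - 1)"

text \<open>
  The real power with $0^0 = 1$; the library has \<open>0 powr 0 = 0\<close>.
\<close>

definition rpow :: "real \<Rightarrow> real \<Rightarrow> real" where
  "rpow x t = (if t = 0 then 1 else x powr t)"

text \<open>
  For integer $s = k+1 < d$ the formulas for $k \le s \le k+1$ and $k+1 \le s \le k+2$ agree, as
  do the formulas for $d-1 \le s \le d$ and $s \ge d$ at $s = d$, so it suffices to use
  \<open>k = \<lfloor>s\<rfloor>\<close> when \<open>s < d\<close>.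
\<close>

definition svf :: "real \<Rightarrow> real^'d^'d \<Rightarrow> real" where
  "svf s A =
     (if s < real CARD('d)
      then let k = nat \<lfloor>s\<rfloor>
           in (\<Prod>i=1..k. singular_value i A) * rpow (singular_value (k + 1) A) (s - real k)
      else rpow \<bar>det A\<bar> (s / real CARD('d)))"

definition elog :: "real \<Rightarrow> ereal" where
  "elog x = (if x = 0 then -\<infinity> else ereal (ln x))"

definition word_prod :: "real^'d^'d^'N \<Rightarrow> 'N list \<Rightarrow> real^'d^'d" where
  "word_prod A w = foldr (\<lambda>i M. A $ i ** M) w (mat 1)"

definition pressure :: "real^'d^'d^'N \<Rightarrow> real \<Rightarrow> ereal" where
  "pressure A s =
     lim (\<lambda>n. ereal (1 / real n) * elog (\<Sum>w | length w = n. svf s (word_prod A w)))"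

text \<open>
  The infimum is taken in the extended reals, so that it would be \<open>\<infinity>\<close> if no \<open>s\<close> qualified.
\<close>

definition affinity_dim :: "real^'d^'d^'N \<Rightarrow> ereal" where
  "affinity_dim A = Inf (ereal ` {s. s > 0 \<and> pressure A s < 0})"

end

theory Submission
  imports Defs
begin

text \<open>
  Upper semicontinuity of the affinity dimension is soft: \<open>\<phi>\<^sup>s\<close> is comparable to a continuous
  submultiplicative function \<open>f\<close>, so the pressure at \<open>s\<close> is negative iff some level sum
  \<open>S n = (\<Sum>w | length w = n. f (A\<^sub>w))\<close> with \<open>n \<ge> 1\<close> is smaller than 1
  (\<open>pressure_neg_iff\<close>), and this is an open condition on \<open>A\<close>.

  Lower semicontinuity needs a closed condition that is implied by negative pressure at \<open>s\<close> and
  that still forces negative pressure at every \<open>t > s\<close>.  The condition used here is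
  \<open>S (D * n) \<le> K * S n ^ (D - 1)\<close> for all \<open>n \<ge> 1\<close>, with \<open>D\<close> and \<open>K\<close> not depending on \<open>A\<close>;
  it parallels Bochi's inequality for the joint spectral radius.  Taking logarithms, dividing by
  \<open>n\<close> and letting \<open>n\<close> grow, the growth exponent \<open>P\<close> of \<open>S\<close> satisfies \<open>D * P \<le> (D - 1) * P\<close>, so
  \<open>P \<le> 0\<close>; as the matrices are strict contractions, passing from \<open>s\<close> to \<open>t\<close> gains an exponential
  factor (\<open>spread_imp_pressure_neg\<close>).

  That the condition follows from negative pressure is \<open>spread_inequality\<close>, which concerns
  \<open>D \<times> D\<close> matrices \<open>B\<^sub>w\<close> and the sums of \<open>\<parallel>B\<^sub>w\<parallel>\<^sup>p\<close>.  Convergence of the sums makes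
  \<open>f(v) = (\<Sum>m. \<Sum>\<^bsub>|w| = mn\<^esub> \<parallel>B\<^sub>w v\<parallel>\<^sup>p)\<close> finite; \<open>f\<close> is the \<open>p\<close>-th power of a quasinorm, and
  on average it does not increase under the words of length \<open>n\<close>.  There is a basis that is at once
  well conditioned for the usual norm and for \<open>f\<close>, with \<open>f\<close> essentially increasing along it
  (\<open>adapted_basis_exists\<close>).  In this basis the matrix entries leading to a basis vector with an
  index at least as large have bounded \<open>p\<close>-th power sums, and an entry leading to a smaller index
  costs at most a constant times \<open>S n\<close>.  A path of \<open>D\<close> steps through \<open>D\<close> indices cannot descend at every step, so at
  most \<open>D - 1\<close> factors \<open>S n\<close> occur.

  To apply this to \<open>\<phi>\<^sup>s\<close>, it is written up to constants as a power of the norm of a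
  finite-dimensional representation.  For \<open>s = k + b / q\<close> below the dimension this is the tensor
  product of \<open>q - b\<close> copies of the \<open>k\<close>-th and \<open>b\<close> copies of the \<open>(k+1)\<close>-st exterior power, raised
  to the power \<open>1 / q\<close> (\<open>svf_rational_comparable_young_norm\<close>); above the dimension it is a power of
  the determinant.  The comparison with singular values comes from
  \<open>\<parallel>\<rho>(A)\<parallel>\<^sup>2 = trace \<rho>(A\<^sup>T A)\<close> for the Frobenius norm and an orthogonal diagonalisation of
  \<open>A\<^sup>T A\<close> (\<open>young_norm_comparable\<close>).  Only rational \<open>s\<close> are covered in this way, but they are dense
  and the sign of the pressure is monotone in \<open>s\<close>.
\<close>

section \<open>Bases adapted to a quasinorm\<close>

definition supported_on :: "'i set \<Rightarrow> ('i \<Rightarrow> real) set" where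
  "supported_on Y = {v. \<forall>x. x \<notin> Y \<longrightarrow> v x = 0}"

text \<open>
  The \<open>p\<close>-th power of a quasinorm that dominates the maximum norm; \<open>C\<close> is the constant
  of the quasi-triangle inequality, which cannot be 1 in general when \<open>p > 1\<close>.
\<close>

definition gauge_on :: "real \<Rightarrow> real \<Rightarrow> 'i set \<Rightarrow> (('i \<Rightarrow> real) \<Rightarrow> real) \<Rightarrow> bool" where
  "gauge_on p C Y f \<longleftrightarrow>
     (\<forall>c. \<forall>v\<in>supported_on Y. f (\<lambda>x. c * v x) = \<bar>c\<bar> powr p * f v) \<and>
     (\<forall>u\<in>supported_on Y. \<forall>v\<in>supported_on Y. f (\<lambda>x. u x + v x) \<le> C * (f u + f v)) \<and>
     (\<forall>v\<in>supported_on Y. \<forall>x\<in>Y. \<bar>v x\<bar> powr p \<le> f v)"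

text \<open>
  The functions \<open>c k\<close> give the coordinates with respect to the vectors \<open>v k\<close>.  The third and
  fourth clause bound every single coordinate in the maximum norm and in \<open>f\<close>; the last one orders
  the basis by \<open>f\<close>, up to a factor 2.
\<close>

definition adapted_basis ::
  "real \<Rightarrow> real \<Rightarrow> 'i set \<Rightarrow> (('i \<Rightarrow> real) \<Rightarrow> real) \<Rightarrow> nat \<Rightarrow>
     (nat \<Rightarrow> 'i \<Rightarrow> real) \<Rightarrow> (nat \<Rightarrow> ('i \<Rightarrow> real) \<Rightarrow> real) \<Rightarrow> bool" where
  "adapted_basis p C Y f D v c \<longleftrightarrow>
     (\<forall>k<D. v k \<in> supported_on Y \<and> (\<forall>x\<in>Y. \<bar>v k x\<bar> \<le> 1) \<and> (\<exists>x\<in>Y. v k x = 1)) \<and>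
     (\<forall>u\<in>supported_on Y. \<forall>x\<in>Y. u x = (\<Sum>k<D. c k u * v k x)) \<and>
     (\<forall>u\<in>supported_on Y. \<forall>k<D. \<forall>M. (\<forall>x\<in>Y. \<bar>u x\<bar> \<le> M) \<longrightarrow> \<bar>c k u\<bar> \<le> C * M) \<and>
     (\<forall>u\<in>supported_on Y. \<forall>k<D. \<bar>c k u\<bar> powr p * f (v k) \<le> C * f u) \<and>
     (\<forall>k l. k \<le> l \<longrightarrow> l < D \<longrightarrow> f (v k) \<le> 2 * f (v l))"

text \<open>
  Gaussian elimination with complete pivoting.  The first basis vector almost minimises \<open>f\<close> among the
  vectors of maximum norm 1, and a coordinate where it equals 1 is eliminated.  Minimality
  makes \<open>f\<close> of the eliminated part at most twice \<open>f u\<close>, so the remainder, which lives on one index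
  fewer, is also controlled by \<open>f u\<close>.
\<close>

lemma adapted_basis_Suc:
  assumes Y: "finite Y" "card Y = Suc D" and f: "gauge_on p C0 Y f" and p: "p > 0" and C0: "C0 \<ge> 1"
    and C: "C \<ge> 1"
    and IH: "\<And>Y' :: 'i set. finite Y' \<Longrightarrow> card Y' = D \<Longrightarrow> gauge_on p C0 Y' f \<Longrightarrow>
               \<exists>v c. adapted_basis p C Y' f D v c"
  shows "\<exists>v c. adapted_basis p (3 * C0 * C) Y f (Suc D) v c"
proof -
  have hom: "f (\<lambda>x. c * v x) = \<bar>c\<bar> powr p * f v" if "v \<in> supported_on Y" for c v
    using f that by (simp add: gauge_on_def)
  have sub: "f (\<lambda>x. u x + v x) \<le> C0 * (f u + f v)" if "u \<in> supported_on Y" "v \<in> supported_on Y" for u v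
    using f that by (simp add: gauge_on_def)
  have low: "\<bar>v x\<bar> powr p \<le> f v" if "v \<in> supported_on Y" "x \<in> Y" for v x
    using f that by (simp add: gauge_on_def)
  have "Y \<noteq> {}" using Y by auto
  have f0: "0 \<le> f v" if "v \<in> supported_on Y" for v
    using low[OF that] \<open>Y \<noteq> {}\<close> by (metis all_not_in_conv order_trans powr_ge_zero)
  define U where "U = {v \<in> supported_on Y. (\<forall>x\<in>Y. \<bar>v x\<bar> \<le> 1) \<and> (\<exists>x\<in>Y. v x = 1)}"
  have U1: "1 \<le> f v" if "v \<in> U" for v
    using that low[of v] unfolding U_def by force
  obtain y where y: "y \<in> Y" using \<open>Y \<noteq> {}\<close> by auto
  have Une: "(\<lambda>x. if x = y then 1 else 0) \<in> U"
    using y by (auto simp: U_def supported_on_def)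
  define m where "m = Inf (f ` U)"
  have bdd: "bdd_below (f ` U)" using U1 by (auto intro!: bdd_belowI[of _ 1])
  have m1: "1 \<le> m" unfolding m_def using U1 Une by (intro cInf_greatest) auto
  have mU: "m \<le> f v" if "v \<in> U" for v
    unfolding m_def using bdd that by (intro cInf_lower) auto
  have "\<exists>v0\<in>U. f v0 < 2 * m"
  proof -
    have "Inf (f ` U) < 2 * m" using m1 by (simp add: m_def[symmetric])
    then show ?thesis using cInf_lessD[of "f ` U" "2 * m"] Une by auto
  qed
  then obtain v0 where v0: "v0 \<in> U" "f v0 < 2 * m" by auto
  have v0Y: "v0 \<in> supported_on Y" using v0 by (simp add: U_def)
  obtain x0 where x0: "x0 \<in> Y" "v0 x0 = 1" using v0 by (auto simp: U_def)
  \<comment> \<open>By homogeneity the bound extends from \<open>U\<close>, where it is the definition of \<open>m\<close>, to all vectors.\<close>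
  have min: "\<bar>u x\<bar> powr p * m \<le> f u" if u: "u \<in> supported_on Y" and x: "x \<in> Y" for u x
  proof -
    obtain z where z: "z \<in> Y" "\<And>x. x \<in> Y \<Longrightarrow> \<bar>u x\<bar> \<le> \<bar>u z\<bar>"
    proof -
      have "Max ((\<lambda>x. \<bar>u x\<bar>) ` Y) \<in> (\<lambda>x. \<bar>u x\<bar>) ` Y" using Y \<open>Y \<noteq> {}\<close> by (intro Max_in) auto
      then obtain z where "z \<in> Y" "Max ((\<lambda>x. \<bar>u x\<bar>) ` Y) = \<bar>u z\<bar>" by auto
      then show ?thesis using that[of z] Y by (metis Max_ge finite_imageI imageI)
    qed
    show ?thesis
    proof (cases "u z = 0")
      case True
      then have "u x = 0" using z(2)[OF x] by simp
      then show ?thesis using f0[OF u] by simp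
    next
      case False
      define w where "w = (\<lambda>x. (1 / u z) * u x)"
      have wU: "w \<in> U" using z False u by (auto simp: U_def w_def supported_on_def field_simps)
      have "f w = \<bar>1 / u z\<bar> powr p * f u" unfolding w_def by (rule hom[OF u])
      then have "\<bar>u z\<bar> powr p * f w = (\<bar>u z\<bar> powr p * \<bar>1 / u z\<bar> powr p) * f u" by simp
      also have "\<bar>u z\<bar> powr p * \<bar>1 / u z\<bar> powr p = 1"
        using False by (simp add: powr_divide)
      finally have "f u = \<bar>u z\<bar> powr p * f w" by simp
      moreover have "\<bar>u x\<bar> powr p * m \<le> \<bar>u z\<bar> powr p * f w"
        using z(2)[OF x] mU[OF wU] p m1 by (intro mult_mono powr_mono2) auto
      ultimately show ?thesis by simp
    qed
  qed
  define Y' where "Y' = Y - {x0}"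
  have Y': "finite Y'" "card Y' = D" using Y x0 by (auto simp: Y'_def)
  have supp: "supported_on Y' \<subseteq> supported_on Y" by (auto simp: supported_on_def Y'_def)
  have "gauge_on p C0 Y' f"
    unfolding gauge_on_def using supp hom sub low by (force simp: Y'_def subset_iff)
  from IH[OF Y' this] obtain v c where vc: "adapted_basis p C Y' f D v c" by blast
  have vsupp: "v k \<in> supported_on Y'" and vle: "\<And>x. x \<in> Y' \<Longrightarrow> \<bar>v k x\<bar> \<le> 1" and vone: "\<exists>x\<in>Y'. v k x = 1" if "k < D" for k
    using vc that by (auto simp: adapted_basis_def)
  define r where "r = (\<lambda>u x. u x + (- u x0) * v0 x)"
  define V where "V = (\<lambda>k. case k of 0 \<Rightarrow> v0 | Suc j \<Rightarrow> v j)"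
  define c' where "c' = (\<lambda>k u. case k of 0 \<Rightarrow> u x0 | Suc j \<Rightarrow> c j (r u))"
  have rsupp: "r u \<in> supported_on Y'" if "u \<in> supported_on Y" for u
    using that v0Y x0 by (auto simp: r_def supported_on_def Y'_def)
  have fr: "f (r u) \<le> 3 * C0 * f u" if u: "u \<in> supported_on Y" for u
  proof -
    have s: "(\<lambda>x. (- u x0) * v0 x) \<in> supported_on Y" using v0Y by (auto simp: supported_on_def)
    have "f (r u) \<le> C0 * (f u + f (\<lambda>x. (- u x0) * v0 x))"
      unfolding r_def by (rule sub[OF u s])
    also have "f (\<lambda>x. (- u x0) * v0 x) = \<bar>u x0\<bar> powr p * f v0"
      using hom[OF v0Y, of "- u x0"] by simp
    also have "C0 * (f u + \<bar>u x0\<bar> powr p * f v0) \<le> C0 * (f u + 2 * f u)"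
    proof -
      have "\<bar>u x0\<bar> powr p * f v0 \<le> \<bar>u x0\<bar> powr p * (2 * m)" using v0 by (intro mult_left_mono) auto
      also have "\<dots> \<le> 2 * f u" using min[OF u x0(1)] by simp
      finally show ?thesis using C0 by simp
    qed
    finally show ?thesis by simp
  qed
  have C3: "C \<le> 3 * C0 * C" "3 \<le> 3 * C0 * C"
    using C C0 mult_mono[of 1 C0 1 C] by (auto simp: mult.assoc)
  have "adapted_basis p (3 * C0 * C) Y f (Suc D) V c'"
    unfolding adapted_basis_def
  proof (intro conjI allI impI ballI)
    fix k assume k: "k < Suc D"
    show "V k \<in> supported_on Y"
      using v0Y vsupp supp k by (cases k) (auto simp: V_def)
    show "\<bar>V k x\<bar> \<le> 1" if "x \<in> Y" for x
    proof (cases k)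
      case 0 then show ?thesis using v0 that by (auto simp: V_def U_def)
    next
      case (Suc j)
      then have "\<bar>v j x\<bar> \<le> 1"
        using vle[of j x] vsupp[of j] k that by (cases "x \<in> Y'") (auto simp: supported_on_def)
      then show ?thesis using Suc by (simp add: V_def)
    qed
    show "\<exists>x\<in>Y. V k x = 1"
      using x0 vone k by (cases k) (auto simp: V_def Y'_def)
  next
    fix u x assume u: "u \<in> supported_on Y" and x: "x \<in> Y"
    have "r u x = (\<Sum>k<D. c k (r u) * v k x)"
    proof (cases "x \<in> Y'")
      case True then show ?thesis using vc rsupp[OF u] by (simp add: adapted_basis_def)
    next
      case False
      then have "r u x = 0" "\<And>k. k < D \<Longrightarrow> v k x = 0"
        using rsupp[OF u] vsupp by (auto simp: supported_on_def)
      then show ?thesis by simp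
    qed
    then show "u x = (\<Sum>k<Suc D. c' k u * V k x)"
      by (subst sum.lessThan_Suc_shift) (simp add: c'_def V_def r_def)
  next
    fix u k M assume u: "u \<in> supported_on Y" and k: "k < Suc D" and M: "\<forall>x\<in>Y. \<bar>u x\<bar> \<le> M"
    have M0: "0 \<le> M" using M x0 by force
    show "\<bar>c' k u\<bar> \<le> 3 * C0 * C * M"
    proof (cases k)
      case 0
      have "\<bar>u x0\<bar> \<le> M" using M x0 by blast
      also have "\<dots> \<le> 3 * C0 * C * M" using C3 M0 by (simp add: mult_le_cancel_right1)
      finally show ?thesis using 0 by (simp add: c'_def)
    next
      case (Suc j)
      have "\<forall>x\<in>Y'. \<bar>r u x\<bar> \<le> 2 * M"
      proof
        fix x assume "x \<in> Y'"
        then have x: "x \<in> Y" by (simp add: Y'_def)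
        have "\<bar>r u x\<bar> \<le> \<bar>u x\<bar> + \<bar>u x0\<bar> * \<bar>v0 x\<bar>"
          unfolding r_def abs_mult[symmetric] by linarith
        also have "\<dots> \<le> M + M * 1"
          using M x x0 v0 M0 by (intro add_mono mult_mono) (auto simp: U_def)
        finally show "\<bar>r u x\<bar> \<le> 2 * M" by simp
      qed
      then have "\<bar>c j (r u)\<bar> \<le> C * (2 * M)"
        using vc rsupp[OF u] Suc k by (auto simp: adapted_basis_def)
      also have "\<dots> \<le> 3 * C0 * C * M"
      proof -
        have "2 * (C * M) \<le> 3 * C0 * (C * M)"
          using C C0 M0 by (intro mult_right_mono) auto
        then show ?thesis by (simp add: mult_ac)
      qed
      finally show ?thesis using Suc by (simp add: c'_def)
    qed
  next
    fix u k assume u: "u \<in> supported_on Y" and k: "k < Suc D"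
    show "\<bar>c' k u\<bar> powr p * f (V k) \<le> 3 * C0 * C * f u"
    proof (cases k)
      case 0
      have "\<bar>u x0\<bar> powr p * f v0 \<le> \<bar>u x0\<bar> powr p * (2 * m)" using v0 by (intro mult_left_mono) auto
      also have "\<dots> \<le> 2 * f u" using min[OF u x0(1)] by simp
      also have "\<dots> \<le> 3 * C0 * C * f u" using C3 f0[OF u] by (intro mult_right_mono) auto
      finally show ?thesis using 0 by (simp add: c'_def V_def)
    next
      case (Suc j)
      have "\<bar>c j (r u)\<bar> powr p * f (v j) \<le> C * f (r u)"
        using vc rsupp[OF u] Suc k by (auto simp: adapted_basis_def)
      also have "\<dots> \<le> C * (3 * C0 * f u)" using fr[OF u] C by (intro mult_left_mono) auto
      finally show ?thesis using Suc by (simp add: c'_def V_def mult_ac)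
    qed
  next
    fix k l :: nat assume kl: "k \<le> l" "l < Suc D"
    show "f (V k) \<le> 2 * f (V l)"
    proof (cases l)
      case 0
      then show ?thesis using kl f0[OF v0Y] by (simp add: V_def)
    next
      case (Suc j)
      have j: "j < D" using Suc kl by simp
      obtain z where z: "z \<in> Y'" "v j z = 1" using vone[OF j] by auto
      have "m \<le> f (v j)" using min[of "v j" z] vsupp[OF j] supp z by (auto simp: Y'_def)
      then have "f (V 0) \<le> 2 * f (V l)" using v0 Suc by (simp add: V_def)
      moreover have "f (V k) \<le> 2 * f (V l)" if "k = Suc i" for i
        using vc that Suc kl by (simp add: V_def adapted_basis_def)
      ultimately show ?thesis by (cases k) auto
    qed
  qed
  then show ?thesis by blast
qed

text \<open>
  The point is the uniformity: \<open>C\<close> depends only on \<open>p\<close>, \<open>C0\<close> and the dimension \<open>D\<close>, not on \<open>f\<close>.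
\<close>

lemma adapted_basis_exists:
  assumes p: "p > 0" and C0: "C0 \<ge> 1"
  shows "\<exists>C\<ge>1. \<forall>(Y :: 'i set) f. finite Y \<and> card Y = D \<and> gauge_on p C0 Y f \<longrightarrow>
           (\<exists>v c. adapted_basis p C Y f D v c)"
proof (induction D)
  case 0
  then show ?case
    by (intro exI[of _ 1]) (auto simp: adapted_basis_def supported_on_def)
next
  case (Suc D)
  then obtain C where C: "C \<ge> 1" and
    IH: "\<And>(Y :: 'i set) f. finite Y \<Longrightarrow> card Y = D \<Longrightarrow> gauge_on p C0 Y f \<Longrightarrow>
           \<exists>v c. adapted_basis p C Y f D v c"
    by blast
  have "3 * C0 * C \<ge> 1"
    using C C0 mult_mono[of 1 C0 1 C] by (auto simp: mult.assoc)
  moreover have "\<exists>v c. adapted_basis p (3 * C0 * C) Y f (Suc D) v c"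
    if "finite Y" "card Y = Suc D" "gauge_on p C0 Y f" for Y :: "'i set" and f
    using adapted_basis_Suc[OF that p C0 C] IH by blast
  ultimately show ?case by blast
qed

section \<open>A growth inequality for products of matrices\<close>

definition vec_norm1 :: "'i set \<Rightarrow> ('i \<Rightarrow> real) \<Rightarrow> real" where
  "vec_norm1 X v = (\<Sum>x\<in>X. \<bar>v x\<bar>)"

definition mat_norm1 :: "'i set \<Rightarrow> ('i \<Rightarrow> 'i \<Rightarrow> real) \<Rightarrow> real" where
  "mat_norm1 X M = (\<Sum>x\<in>X. \<Sum>y\<in>X. \<bar>M x y\<bar>)"

definition mat_act :: "'i set \<Rightarrow> ('i \<Rightarrow> 'i \<Rightarrow> real) \<Rightarrow> ('i \<Rightarrow> real) \<Rightarrow> 'i \<Rightarrow> real" where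
  "mat_act X M v = (\<lambda>x. if x \<in> X then \<Sum>y\<in>X. M x y * v y else 0)"

lemma vec_norm1_nonneg: "0 \<le> vec_norm1 X v"
  by (simp add: vec_norm1_def sum_nonneg)

lemma mat_norm1_nonneg: "0 \<le> mat_norm1 X M"
  by (simp add: mat_norm1_def sum_nonneg)

lemma vec_norm1_act_le:
  assumes "\<And>y. y \<in> X \<Longrightarrow> \<bar>v y\<bar> \<le> c"
  shows "vec_norm1 X (mat_act X M v) \<le> mat_norm1 X M * c"
proof -
  have "vec_norm1 X (mat_act X M v) = (\<Sum>x\<in>X. \<bar>\<Sum>y\<in>X. M x y * v y\<bar>)"
    by (simp add: vec_norm1_def mat_act_def)
  also have "\<dots> \<le> (\<Sum>x\<in>X. \<Sum>y\<in>X. \<bar>M x y\<bar> * c)"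
    by (intro sum_mono order_trans[OF sum_abs]) (auto simp: abs_mult intro!: mult_left_mono assms)
  also have "\<dots> = mat_norm1 X M * c"
    by (simp add: mat_norm1_def sum_distrib_right)
  finally show ?thesis .
qed

lemma member_le_vec_norm1: "finite X \<Longrightarrow> y \<in> X \<Longrightarrow> \<bar>v y\<bar> \<le> vec_norm1 X v"
  unfolding vec_norm1_def by (rule member_le_sum) auto

lemma vec_norm1_act_le':
  "finite X \<Longrightarrow> vec_norm1 X (mat_act X M v) \<le> mat_norm1 X M * vec_norm1 X v"
  by (intro vec_norm1_act_le member_le_vec_norm1)

lemma finite_words: "finite {w :: 'n::finite list. length w = n}"
  using finite_lists_length_eq[of "UNIV :: 'n set" n] by simp

lemma sum_words_add:
  fixes F :: "'n::finite list \<Rightarrow> 'b::comm_monoid_add"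
  shows "(\<Sum>w | length w = a + b. F w) = (\<Sum>u | length u = a. \<Sum>v | length v = b. F (u @ v))"
proof -
  have "(\<Sum>u | length u = a. \<Sum>v | length v = b. F (u @ v)) =
        (\<Sum>(u, v) \<in> {u. length u = a} \<times> {v. length v = b}. F (u @ v))"
    by (rule sum.cartesian_product)
  also have "\<dots> = (\<Sum>w | length w = a + b. F w)"
    by (rule sum.reindex_bij_witness[where j = "\<lambda>(u, v). u @ v" and i = "\<lambda>w. (take a w, drop a w)"]) auto
  finally show ?thesis by simp
qed

text \<open>
  A crude substitute, valid for every \<open>p > 0\<close>, for convexity (\<open>p \<ge> 1\<close>) and subadditivity (\<open>p \<le> 1\<close>).
\<close>

lemma powr_sum_le:
  fixes a :: "'b \<Rightarrow> real"
  assumes S: "finite S" and p: "p > 0" and a: "\<And>x. x \<in> S \<Longrightarrow> 0 \<le> a x"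
  shows "(\<Sum>x\<in>S. a x) powr p \<le> real (card S) powr p * (\<Sum>x\<in>S. a x powr p)"
proof (cases "S = {}")
  case True then show ?thesis by simp
next
  case False
  have "Max (a ` S) \<in> a ` S" using S False by (intro Max_in) auto
  then obtain z where z: "z \<in> S" "Max (a ` S) = a z" by auto
  have le: "a x \<le> a z" if "x \<in> S" for x
    unfolding z(2)[symmetric] using S that by simp
  have "(\<Sum>x\<in>S. a x) \<le> real (card S) * a z"
    using sum_bounded_above[of S a "a z"] le by simp
  then have "(\<Sum>x\<in>S. a x) powr p \<le> (real (card S) * a z) powr p"
    using a p by (intro powr_mono2) (auto intro: sum_nonneg)
  also have "\<dots> = real (card S) powr p * a z powr p"
    using a z by (simp add: powr_mult)
  also have "a z powr p \<le> (\<Sum>x\<in>S. a x powr p)"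
    using S z by (intro member_le_sum) auto
  finally show ?thesis by (simp add: mult_left_mono)
qed

lemma powr_add_le:
  fixes a b :: real
  assumes "p > 0" "a \<ge> 0" "b \<ge> 0"
  shows "(a + b) powr p \<le> 2 powr p * (a powr p + b powr p)"
  using powr_sum_le[of "{0::nat,1}" p "\<lambda>i. if i = 0 then a else b"] assms by simp

text \<open>
  The core of \<open>spread_inequality\<close>, with explicit constants.  Here \<open>e l k\<close> is the \<open>p\<close>-th power sum of
  the matrix entries from \<open>v k\<close> to \<open>v l\<close> over the words of length \<open>n\<close>.  It is at most a constant
  times \<open>S n\<close> in general, and at most \<open>2 * C\<close> if \<open>k \<le> l\<close>, because \<open>f\<close> does not increase on average
  while \<open>f (v k) \<le> 2 * f (v l)\<close>.  Induction on \<open>k\<close> then shows that, once \<open>m \<ge> k\<close>, the images of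
  \<open>v k\<close> under \<open>m + 1\<close> blocks of length \<open>n\<close> cost only \<open>m\<close> factors \<open>S n\<close>.
\<close>

lemma spread_inequality_aux:
  fixes X :: "'i set" and B :: "'n::finite list \<Rightarrow> 'i \<Rightarrow> 'i \<Rightarrow> real" and p :: real
  defines "S \<equiv> \<lambda>n. \<Sum>w | length w = n. mat_norm1 X (B w) powr p"
  assumes X: "finite X" "card X = D" "D > 0" and p: "p > 0"
    and one: "\<And>x y. x \<in> X \<Longrightarrow> y \<in> X \<Longrightarrow> B [] x y = (if x = y then 1 else 0)"
    and mult: "\<And>u v x y. x \<in> X \<Longrightarrow> y \<in> X \<Longrightarrow> B (u @ v) x y = (\<Sum>z\<in>X. B u x z * B v z y)"
    and summ: "summable (\<lambda>m. S (m * n))"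
    and C: "C \<ge> 1"
    and basis: "\<And>f. gauge_on p (2 powr p) X f \<Longrightarrow> \<exists>v c. adapted_basis p C X f D v c"
    and H: "H = real D powr p * (D * (C powr p + 2 * C * real D powr p)) + 1"
  shows "S (D * n) \<le> (D * C) powr p * (real D powr p * (D * H ^ D)) * S n ^ (D - 1)"
proof -
  define \<phi> where "\<phi> = (\<lambda>w v. vec_norm1 X (mat_act X (B w) v) powr p)"
  define g where "g = (\<lambda>m v. \<Sum>w | length w = m * n. \<phi> w v)"
  define f where "f = (\<lambda>v. \<Sum>m. g m v)"
  note fin = finite_words
  have phi0: "0 \<le> \<phi> w v" for w v by (simp add: \<phi>_def)
  have g0: "0 \<le> g m v" for m v by (simp add: g_def phi0 sum_nonneg)
  have S0: "0 \<le> S k" for k by (simp add: S_def sum_nonneg)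
  have act_append: "mat_act X (B (u @ v)) z = mat_act X (B u) (mat_act X (B v) z)" for u v z
  proof
    fix x
    have "(\<Sum>y\<in>X. (\<Sum>k\<in>X. B u x k * B v k y) * z y) = (\<Sum>k\<in>X. B u x k * (\<Sum>y\<in>X. B v k y * z y))"
      unfolding sum_distrib_left sum_distrib_right
      by (subst sum.swap) (simp add: mult_ac)
    then show "mat_act X (B (u @ v)) z x = mat_act X (B u) (mat_act X (B v) z) x"
      using mult by (simp add: mat_act_def)
  qed
  have phi_append: "\<phi> (u @ v) z = \<phi> u (mat_act X (B v) z)" for u v z
    by (simp add: \<phi>_def act_append)
  have phi_le: "\<phi> w v \<le> mat_norm1 X (B w) powr p * vec_norm1 X v powr p" for w v
    unfolding \<phi>_def using vec_norm1_act_le'[OF X(1), of "B w" v] p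
    by (simp add: powr_mult[symmetric] powr_mono2 vec_norm1_nonneg mat_norm1_nonneg)
  have g_le: "g m v \<le> S (m * n) * vec_norm1 X v powr p" for m v
    unfolding g_def S_def sum_distrib_right by (intro sum_mono phi_le)
  have summ_g: "summable (\<lambda>m. g m v)" for v
    by (rule summable_comparison_test'[OF summable_mult2[OF summ, of "vec_norm1 X v powr p"], of 0])
       (use g_le g0 in auto)
  have gf: "g m v \<le> f v" for m v
    unfolding f_def using sum_le_suminf[OF summ_g[of v], of "{m}"] g0 by auto
  have phi_nil: "\<phi> [] v = vec_norm1 X v powr p" for v
  proof -
    have "(\<Sum>y\<in>X. B [] x y * v y) = v x" if "x \<in> X" for x
      using that X(1) by (simp add: one if_distrib[of "\<lambda>t. t * _"] cong: if_cong)
    then show ?thesis by (simp add: \<phi>_def vec_norm1_def mat_act_def)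
  qed
  have g_0: "g 0 v = vec_norm1 X v powr p" for v
    by (simp add: g_def phi_nil)
  have act_supp: "mat_act X M v \<in> supported_on X" for M v
    by (simp add: mat_act_def supported_on_def)
  have gauge: "gauge_on p (2 powr p) X f"
    unfolding gauge_on_def
  proof (intro conjI allI ballI)
    fix c v
    have "mat_act X M (\<lambda>x. c * v x) = (\<lambda>x. c * mat_act X M v x)" for M
      by (auto simp: mat_act_def sum_distrib_left mult_ac)
    then have "\<phi> w (\<lambda>x. c * v x) = \<bar>c\<bar> powr p * \<phi> w v" for w
      by (simp add: \<phi>_def vec_norm1_def abs_mult sum_distrib_left[symmetric] powr_mult sum_nonneg)
    then have "g m (\<lambda>x. c * v x) = \<bar>c\<bar> powr p * g m v" for m
      by (simp add: g_def sum_distrib_left)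
    then show "f (\<lambda>x. c * v x) = \<bar>c\<bar> powr p * f v"
      using summ_g by (simp add: f_def suminf_mult)
  next
    fix u v
    have "mat_act X M (\<lambda>x. u x + v x) = (\<lambda>x. mat_act X M u x + mat_act X M v x)" for M
      by (auto simp: mat_act_def sum.distrib distrib_left)
    then have "vec_norm1 X (mat_act X M (\<lambda>x. u x + v x)) \<le>
        vec_norm1 X (mat_act X M u) + vec_norm1 X (mat_act X M v)" for M
      by (simp add: vec_norm1_def sum.distrib[symmetric] sum_mono abs_triangle_ineq)
    then have "\<phi> w (\<lambda>x. u x + v x) \<le> 2 powr p * (\<phi> w u + \<phi> w v)" for w
      unfolding \<phi>_def using p
      by (intro order_trans[OF powr_mono2 powr_add_le]) (auto simp: vec_norm1_nonneg)
    then have "g m (\<lambda>x. u x + v x) \<le> 2 powr p * (g m u + g m v)" for m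
      unfolding g_def sum.distrib[symmetric] sum_distrib_left by (intro sum_mono)
    then have "f (\<lambda>x. u x + v x) \<le> (\<Sum>m. 2 powr p * (g m u + g m v))"
      unfolding f_def using summ_g by (intro suminf_le summable_mult summable_add)
    also have "\<dots> = 2 powr p * (f u + f v)"
      unfolding f_def using summ_g by (simp add: suminf_mult suminf_add summable_add)
    finally show "f (\<lambda>x. u x + v x) \<le> 2 powr p * (f u + f v)" .
  next
    fix v x assume "x \<in> X"
    then have "\<bar>v x\<bar> powr p \<le> g 0 v"
      using p X(1) by (auto simp: g_0 intro!: powr_mono2 member_le_vec_norm1)
    then show "\<bar>v x\<bar> powr p \<le> f v" using gf[of 0 v] by simp
  qed
  \<comment> \<open>Summing over one more block of length \<open>n\<close> shifts the series and so drops its first term.\<close>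
  have f_step: "(\<Sum>u | length u = n. f (mat_act X (B u) v)) \<le> f v" for v
  proof -
    have "(\<Sum>u | length u = n. f (mat_act X (B u) v)) =
          (\<Sum>m. \<Sum>u | length u = n. g m (mat_act X (B u) v))"
      unfolding f_def using summ_g by (simp add: suminf_sum)
    also have "(\<lambda>m. \<Sum>u | length u = n. g m (mat_act X (B u) v)) = (\<lambda>m. g (Suc m) v)"
    proof
      fix m
      have "g (Suc m) v = (\<Sum>w | length w = m * n + n. \<phi> w v)" by (simp add: g_def add.commute)
      also have "\<dots> = (\<Sum>w | length w = m * n. \<Sum>u | length u = n. \<phi> w (mat_act X (B u) v))"
        by (simp add: sum_words_add phi_append)
      also have "\<dots> = (\<Sum>u | length u = n. g m (mat_act X (B u) v))"
        unfolding g_def by (rule sum.swap)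
      finally show "(\<Sum>u | length u = n. g m (mat_act X (B u) v)) = g (Suc m) v" by simp
    qed
    also have "(\<Sum>m. g (Suc m) v) \<le> f v"
      using suminf_split_head[OF summ_g[of v]] g0[of 0 v] by (simp add: f_def)
    finally show ?thesis .
  qed
  obtain v c where bas: "adapted_basis p C X f D v c" using basis[OF gauge] by blast
  have v_le: "\<And>x. x \<in> X \<Longrightarrow> \<bar>v k x\<bar> \<le> 1" and v_one: "\<exists>x\<in>X. v k x = 1"
    if "k < D" for k
    using bas that by (auto simp: adapted_basis_def)
  have expand: "u x = (\<Sum>k<D. c k u * v k x)" if "u \<in> supported_on X" "x \<in> X" for u x
    using bas that by (auto simp: adapted_basis_def)
  have c_le: "\<bar>c k u\<bar> \<le> C * M" if "u \<in> supported_on X" "k < D" "\<And>x. x \<in> X \<Longrightarrow> \<bar>u x\<bar> \<le> M" for k u M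
    using bas that by (auto simp: adapted_basis_def)
  have c_f: "\<bar>c k u\<bar> powr p * f (v k) \<le> C * f u" if "u \<in> supported_on X" "k < D" for k u
    using bas that by (auto simp: adapted_basis_def)
  have f_mono: "f (v k) \<le> 2 * f (v l)" if "k \<le> l" "l < D" for k l
    using bas that by (auto simp: adapted_basis_def)
  have act_expand: "vec_norm1 X (mat_act X M u) \<le> (\<Sum>k<D. \<bar>c k u\<bar> * vec_norm1 X (mat_act X M (v k)))"
    if u: "u \<in> supported_on X" for M u
  proof -
    have eq: "mat_act X M u x = (\<Sum>k<D. c k u * mat_act X M (v k) x)" if x: "x \<in> X" for x
    proof -
      have "mat_act X M u x = (\<Sum>y\<in>X. M x y * (\<Sum>k<D. c k u * v k y))"
        using x expand[OF u] by (simp add: mat_act_def)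
      also have "\<dots> = (\<Sum>k<D. c k u * (\<Sum>y\<in>X. M x y * v k y))"
        unfolding sum_distrib_left by (subst sum.swap) (simp add: mult_ac)
      finally show ?thesis using x by (simp add: mat_act_def)
    qed
    have "vec_norm1 X (mat_act X M u) \<le> (\<Sum>x\<in>X. \<Sum>k<D. \<bar>c k u\<bar> * \<bar>mat_act X M (v k) x\<bar>)"
      unfolding vec_norm1_def
      by (intro sum_mono, subst eq) (auto simp: abs_mult intro!: order_trans[OF sum_abs])
    also have "\<dots> = (\<Sum>k<D. \<bar>c k u\<bar> * vec_norm1 X (mat_act X M (v k)))"
      unfolding vec_norm1_def sum_distrib_left by (rule sum.swap)
    finally show ?thesis .
  qed
  have phi_expand: "\<phi> w u \<le> real D powr p * (\<Sum>k<D. \<bar>c k u\<bar> powr p * \<phi> w (v k))"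
    if u: "u \<in> supported_on X" for w u
  proof -
    have "\<phi> w u \<le> (\<Sum>k<D. \<bar>c k u\<bar> * vec_norm1 X (mat_act X (B w) (v k))) powr p"
      unfolding \<phi>_def using p act_expand[OF u] by (intro powr_mono2) (auto simp: vec_norm1_nonneg)
    also have "\<dots> \<le> real (card {..<D}) powr p *
        (\<Sum>k<D. (\<bar>c k u\<bar> * vec_norm1 X (mat_act X (B w) (v k))) powr p)"
      using p by (intro powr_sum_le) (auto simp: vec_norm1_nonneg)
    also have "\<dots> = real D powr p * (\<Sum>k<D. \<bar>c k u\<bar> powr p * \<phi> w (v k))"
      by (simp add: \<phi>_def powr_mult vec_norm1_nonneg)
    finally show ?thesis .
  qed
  define G where "G = (\<lambda>m k. g m (v k))"
  define e where "e = (\<lambda>l k. \<Sum>u | length u = n. \<bar>c l (mat_act X (B u) (v k))\<bar> powr p)"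
  have e1: "e l k \<le> C powr p * S n" if lk: "l < D" "k < D" for l k
  proof -
    have "\<bar>c l (mat_act X (B u) (v k))\<bar> powr p \<le> C powr p * mat_norm1 X (B u) powr p" for u
    proof -
      have "\<bar>mat_act X (B u) (v k) x\<bar> \<le> mat_norm1 X (B u)" if "x \<in> X" for x
        using member_le_vec_norm1[OF X(1) that, of "mat_act X (B u) (v k)"]
          vec_norm1_act_le[of X "v k" 1 "B u"] v_le[OF lk(2)] by simp
      then have "\<bar>c l (mat_act X (B u) (v k))\<bar> \<le> C * mat_norm1 X (B u)"
        by (intro c_le act_supp lk)
      then have "\<bar>c l (mat_act X (B u) (v k))\<bar> powr p \<le> (C * mat_norm1 X (B u)) powr p"
        using p by (intro powr_mono2) auto
      then show ?thesis using C mat_norm1_nonneg by (simp add: powr_mult)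
    qed
    then show ?thesis unfolding e_def S_def sum_distrib_left by (intro sum_mono)
  qed
  have e2: "e l k \<le> 2 * C" if kl: "k \<le> l" "l < D" for l k
  proof -
    have k: "k < D" using kl by simp
    obtain x where x: "x \<in> X" "v l x = 1" using v_one[OF kl(2)] by auto
    have "1 \<le> f (v l)"
      using x gf[of 0 "v l"] p member_le_vec_norm1[OF X(1) x(1), of "v l"]
        powr_mono2[of p 1 "vec_norm1 X (v l)"] by (simp add: g_0)
    moreover have "e l k * f (v l) \<le> (2 * C) * f (v l)"
    proof -
      have "e l k * f (v l) \<le> (\<Sum>u | length u = n. C * f (mat_act X (B u) (v k)))"
        unfolding e_def sum_distrib_right by (intro sum_mono c_f act_supp kl)
      also have "\<dots> = C * (\<Sum>u | length u = n. f (mat_act X (B u) (v k)))"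
        by (simp add: sum_distrib_left)
      also have "\<dots> \<le> C * (2 * f (v l))"
        using C f_step[of "v k"] f_mono[OF kl] by (intro mult_left_mono) auto
      finally show ?thesis by (simp add: mult_ac)
    qed
    ultimately show ?thesis by (simp add: mult_le_cancel_right)
  qed
  have G_Suc: "G (Suc m) k \<le> real D powr p * (\<Sum>l<D. e l k * G m l)" if "k < D" for m k
  proof -
    have "G (Suc m) k = (\<Sum>w | length w = m * n + n. \<phi> w (v k))" by (simp add: G_def g_def add.commute)
    also have "\<dots> = (\<Sum>w | length w = m * n. \<Sum>u | length u = n. \<phi> w (mat_act X (B u) (v k)))"
      by (simp add: sum_words_add phi_append)
    also have "\<dots> \<le> (\<Sum>w | length w = m * n. \<Sum>u | length u = n.
        real D powr p * (\<Sum>l<D. \<bar>c l (mat_act X (B u) (v k))\<bar> powr p * \<phi> w (v l)))"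
      by (intro sum_mono phi_expand act_supp)
    also have "\<dots> = real D powr p * (\<Sum>l<D. \<Sum>w | length w = m * n. \<Sum>u | length u = n.
        \<bar>c l (mat_act X (B u) (v k))\<bar> powr p * \<phi> w (v l))"
      unfolding sum_distrib_left[symmetric]
      by (subst sum.swap[of _ _ "{..<D}"], subst (2) sum.swap) simp
    also have "\<dots> = real D powr p * (\<Sum>l<D. e l k * G m l)"
      unfolding e_def G_def g_def by (simp add: sum_product mult.commute)
    finally show ?thesis .
  qed
  have G_S: "G m k \<le> real D powr p * S n ^ m" if k: "k < D" for m k
  proof (induction m)
    case 0
    have "vec_norm1 X (v k) \<le> real D"
      unfolding vec_norm1_def using sum_bounded_above[of X "\<lambda>x. \<bar>v k x\<bar>" 1] v_le[OF k] X by simp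
    then show ?case using p by (simp add: G_def g_0 powr_mono2 vec_norm1_nonneg)
  next
    case (Suc m)
    have "G (Suc m) k = (\<Sum>u | length u = n. \<Sum>w | length w = m * n. \<phi> (u @ w) (v k))"
      by (simp add: G_def g_def sum_words_add)
    also have "\<dots> \<le> (\<Sum>u | length u = n. \<Sum>w | length w = m * n. mat_norm1 X (B u) powr p * \<phi> w (v k))"
      unfolding phi_append
      by (intro sum_mono order_trans[OF phi_le]) (simp add: \<phi>_def)
    also have "\<dots> = S n * G m k"
      by (simp add: S_def G_def g_def sum_product)
    also have "\<dots> \<le> S n * (real D powr p * S n ^ m)"
      by (intro mult_left_mono Suc S0)
    finally show ?case by (simp add: mult_ac)
  qed
  have H1: "1 \<le> H" using H C by simp
  \<comment> \<open>A step to a smaller index \<open>l < k\<close> costs a factor \<open>S n\<close>, but then the hypothesis for \<open>l\<close> saves one;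
    a step to \<open>l \<ge> k\<close> costs only a constant, and the remaining \<open>m\<close> blocks are bounded trivially.\<close>
  have G_main: "G (Suc m) k \<le> H ^ Suc k * S n ^ m" if "k < D" "k \<le> m" for m k
    using that
  proof (induction k arbitrary: m rule: less_induct)
    case (less k)
    have summand: "e l k * G m l \<le> (C powr p + 2 * C * real D powr p) * (H ^ k * S n ^ m)" if l: "l < D" for l
    proof (cases "l < k")
      case True
      then obtain m' where m': "m = Suc m'" "l \<le> m'" using less.prems by (cases m) auto
      have "e l k * G m l \<le> (C powr p * S n) * (H ^ Suc l * S n ^ m')"
        unfolding m'(1) using less.IH[OF True l m'(2)] e1[OF l less.prems(1)] S0[of n] g0 C
        by (intro mult_mono) (auto simp: G_def)
      also have "\<dots> = C powr p * (H ^ Suc l * S n ^ m)" by (simp add: m')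
      also have "\<dots> \<le> C powr p * (H ^ k * S n ^ m)"
        using True H1 S0[of n] by (intro mult_left_mono mult_right_mono power_increasing) auto
      also have "\<dots> \<le> (C powr p + 2 * C * real D powr p) * (H ^ k * S n ^ m)"
        using C H1 S0[of n] by (intro mult_right_mono) auto
      finally show ?thesis .
    next
      case False
      have "e l k * G m l \<le> (2 * C) * (real D powr p * S n ^ m)"
        using e2[of k l] False l G_S[OF l, of m] C g0 by (intro mult_mono) (auto simp: G_def)
      also have "\<dots> \<le> (2 * C * real D powr p) * (H ^ k * S n ^ m)"
        using one_le_power[OF H1, of k] C S0[of n] mult_right_mono[of 1 "H ^ k" "S n ^ m"]
        by (simp add: mult.assoc mult_left_mono)
      also have "\<dots> \<le> (C powr p + 2 * C * real D powr p) * (H ^ k * S n ^ m)"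
        using C H1 S0[of n] by (intro mult_right_mono) auto
      finally show ?thesis .
    qed
    have "G (Suc m) k \<le> real D powr p * (\<Sum>l<D. e l k * G m l)" by (rule G_Suc[OF less.prems(1)])
    also have "\<dots> \<le> real D powr p * (\<Sum>l<D. (C powr p + 2 * C * real D powr p) * (H ^ k * S n ^ m))"
      by (intro mult_left_mono sum_mono summand) auto
    also have "\<dots> = (H - 1) * (H ^ k * S n ^ m)" by (simp add: H)
    also have "\<dots> \<le> H ^ Suc k * S n ^ m"
      using H1 S0[of n] by (simp add: mult.assoc mult_right_mono)
    finally show ?case .
  qed
  have G_D: "G D k \<le> H ^ D * S n ^ (D - 1)" if k: "k < D" for k
  proof -
    have "G D k \<le> H ^ Suc k * S n ^ (D - 1)" using G_main[of k "D - 1"] k by simp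
    also have "\<dots> \<le> H ^ D * S n ^ (D - 1)"
      using k H1 S0[of n] by (intro mult_right_mono power_increasing) auto
    finally show ?thesis .
  qed
  have norm_le: "mat_norm1 X (B w) powr p \<le>
      (D * C) powr p * (real D powr p * (\<Sum>k<D. \<phi> w (v k)))" for w
  proof -
    define E where "E = (\<lambda>(y::'i) x. if x = y then 1 else 0 :: real)"
    have ES: "E y \<in> supported_on X" if "y \<in> X" for y using that by (auto simp: E_def supported_on_def)
    have "mat_norm1 X (B w) = (\<Sum>y\<in>X. vec_norm1 X (mat_act X (B w) (E y)))"
    proof -
      have "vec_norm1 X (mat_act X (B w) (E y)) = (\<Sum>x\<in>X. \<bar>B w x y\<bar>)" if "y \<in> X" for y
        using that X(1) by (simp add: vec_norm1_def mat_act_def E_def if_distrib cong: if_cong)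
      then show ?thesis by (subst mat_norm1_def, subst sum.swap) simp
    qed
    also have "\<dots> \<le> (\<Sum>y\<in>X. \<Sum>k<D. C * vec_norm1 X (mat_act X (B w) (v k)))"
    proof (intro sum_mono order_trans[OF act_expand] ES)
      fix y k assume y: "y \<in> X" and "k \<in> {..<D}"
      then have "\<bar>c k (E y)\<bar> \<le> C * 1" by (intro c_le ES) (auto simp: E_def)
      then show "\<bar>c k (E y)\<bar> * vec_norm1 X (mat_act X (B w) (v k)) \<le>
        C * vec_norm1 X (mat_act X (B w) (v k))"
        by (intro mult_right_mono) (auto simp: vec_norm1_nonneg)
    qed
    also have "\<dots> = (D * C) * (\<Sum>k<D. vec_norm1 X (mat_act X (B w) (v k)))"
      using X by (simp add: sum_distrib_left mult_ac)
    finally have "mat_norm1 X (B w) powr p \<le>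
        ((D * C) * (\<Sum>k<D. vec_norm1 X (mat_act X (B w) (v k)))) powr p"
      using p by (intro powr_mono2) (auto simp: mat_norm1_nonneg)
    also have "\<dots> = (D * C) powr p * (\<Sum>k<D. vec_norm1 X (mat_act X (B w) (v k))) powr p"
      by (rule powr_mult)
    also have "(\<Sum>k<D. vec_norm1 X (mat_act X (B w) (v k))) powr p \<le> real D powr p * (\<Sum>k<D. \<phi> w (v k))"
      unfolding \<phi>_def using powr_sum_le[of "{..<D}" p] p by (simp add: vec_norm1_nonneg)
    finally show ?thesis by (simp add: mult_left_mono)
  qed
  have "S (D * n) \<le> (\<Sum>w | length w = D * n. (D * C) powr p * (real D powr p * (\<Sum>k<D. \<phi> w (v k))))"
    unfolding S_def by (intro sum_mono norm_le)
  also have "\<dots> = (D * C) powr p * (real D powr p * (\<Sum>k<D. G D k))"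
    unfolding G_def g_def by (subst sum.swap) (simp add: sum_distrib_left)
  also have "\<dots> \<le> (D * C) powr p * (real D powr p * (\<Sum>k<D. H ^ D * S n ^ (D - 1)))"
    by (intro mult_left_mono sum_mono G_D) auto
  also have "\<dots> = (D * C) powr p * (real D powr p * (D * H ^ D)) * S n ^ (D - 1)" by simp
  finally show ?thesis .
qed

text \<open>
  Summability involves words of all lengths, whereas for each \<open>n\<close> the conclusion is a closed condition
  on the finitely many matrices of words of length \<open>n\<close> and \<open>card X * n\<close>, with \<open>K\<close> chosen before \<open>B\<close>
  and \<open>n\<close>; therefore it survives passage to limits of \<open>B\<close>.  The identity at the empty
  word makes the first term of the series in the proof the norm of the vector itself.
\<close>

theorem spread_inequality:
  fixes X :: "'i set"
  assumes X: "finite X" "X \<noteq> {}" and p: "p > 0"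
  shows "\<exists>K>0. \<forall>(B :: 'n::finite list \<Rightarrow> 'i \<Rightarrow> 'i \<Rightarrow> real) n.
           (\<forall>x\<in>X. \<forall>y\<in>X. B [] x y = (if x = y then 1 else 0)) \<longrightarrow>
           (\<forall>u v. \<forall>x\<in>X. \<forall>y\<in>X. B (u @ v) x y = (\<Sum>z\<in>X. B u x z * B v z y)) \<longrightarrow>
           summable (\<lambda>m. \<Sum>w | length w = m * n. mat_norm1 X (B w) powr p) \<longrightarrow>
           (\<Sum>w | length w = card X * n. mat_norm1 X (B w) powr p) \<le>
             K * (\<Sum>w | length w = n. mat_norm1 X (B w) powr p) ^ (card X - 1)"
proof -
  define D where "D = card X"
  have D: "card X = D" "D > 0" using X by (auto simp: D_def card_gt_0_iff)
  have "1 \<le> (2::real) powr p" using p by (simp add: ge_one_powr_ge_zero)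
  from adapted_basis_exists[where D = D and 'i = 'i, OF p this]
  obtain C where C: "C \<ge> 1" and basis: "\<And>f. gauge_on p (2 powr p) X f \<Longrightarrow> \<exists>v c. adapted_basis p C X f D v c"
    using X D by blast
  define H where "H = real D powr p * (D * (C powr p + 2 * C * real D powr p)) + 1"
  have "H > 0" using C by (auto simp: H_def intro!: add_nonneg_pos)
  show ?thesis
    unfolding D(1)
  proof (intro exI[of _ "(D * C) powr p * (real D powr p * (D * H ^ D))"] conjI allI impI)
    show "0 < (D * C) powr p * (real D powr p * (D * H ^ D))" using \<open>H > 0\<close> C D by simp
  qed (rule spread_inequality_aux[OF X(1) D p _ _ _ C basis H_def]; blast)
qed

section \<open>Singular values from an orthogonal diagonalisation\<close>

lemma symmetric_inner_matrix:
  fixes A :: "real^'n^'n"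
  assumes "transpose A = A"
  shows "(A *v x) \<bullet> y = x \<bullet> (A *v y)"
  by (metis assms dot_lmul_matrix transpose_matrix_vector)

text \<open>
  A maximiser \<open>v\<close> of the quadratic form on the unit sphere of \<open>S\<close> is an eigenvector: by the first order
  condition, \<open>A *v v\<close> is orthogonal to every vector of \<open>S\<close> that is orthogonal to \<open>v\<close>.
\<close>

lemma symmetric_eigenvector_exists:
  fixes A :: "real^'n^'n"
  assumes sym: "transpose A = A" and S: "subspace S" "S \<noteq> {0}"
    and inv: "\<And>x. x \<in> S \<Longrightarrow> A *v x \<in> S"
  shows "\<exists>v\<in>S. norm v = 1 \<and> (\<exists>m. A *v v = m *\<^sub>R v)"
proof -
  define K where "K = S \<inter> sphere 0 1"
  have K: "compact K" unfolding K_def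
    using S by (simp add: closed_subspace closed_Int_compact)
  obtain s where s: "s \<in> S" "s \<noteq> 0" using S subspace_0[OF S(1)] by auto
  have "(1 / norm s) *\<^sub>R s \<in> K" using s S by (simp add: K_def subspace_scale)
  then have Kne: "K \<noteq> {}" by blast
  have "continuous_on K (\<lambda>x. x \<bullet> (A *v x))"
    by (intro continuous_intros linear_continuous_on matrix_vector_mul_bounded_linear)
  from continuous_attains_sup[OF K Kne this]
  obtain v where v: "v \<in> K" and vmax: "\<And>y. y \<in> K \<Longrightarrow> y \<bullet> (A *v y) \<le> v \<bullet> (A *v v)" by blast
  define m where "m = v \<bullet> (A *v v)"
  have vS: "v \<in> S" and v1: "v \<bullet> v = 1" using v by (auto simp: K_def norm_eq_1)
  have hom: "x \<bullet> (A *v x) \<le> m * (x \<bullet> x)" if x: "x \<in> S" for x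
  proof (cases "x = 0")
    case False
    define y where "y = (1 / norm x) *\<^sub>R x"
    have "y \<in> K" using x S False by (simp add: K_def y_def subspace_scale)
    then have "y \<bullet> (A *v y) \<le> m" unfolding m_def by (rule vmax)
    moreover have "y \<bullet> (A *v y) = (x \<bullet> (A *v x)) / (x \<bullet> x)"
      by (simp add: y_def matrix_vector_mult_scaleR dot_square_norm power2_eq_square divide_simps)
    ultimately show ?thesis using False by (simp add: divide_simps split: if_splits)
  qed simp
  have orth: "w \<bullet> (A *v v) = 0" if w: "w \<in> S" "w \<bullet> v = 0" for w
  proof -
    define b where "b = w \<bullet> (A *v v)"
    define a where "a = m * (w \<bullet> w) - w \<bullet> (A *v w)"
    have *: "2 * t * b \<le> t\<^sup>2 * a" for t :: real
    proof -
      have "v + t *\<^sub>R w \<in> S" using vS w S by (simp add: subspace_add subspace_scale)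
      from hom[OF this] have "m + 2 * t * b + t\<^sup>2 * (w \<bullet> (A *v w)) \<le> m * (1 + t\<^sup>2 * (w \<bullet> w))"
        using w v1 symmetric_inner_matrix[OF sym, of v w]
        by (simp add: inner_add_left inner_add_right matrix_vector_right_distrib matrix_vector_mult_scaleR
            m_def[symmetric] b_def power2_eq_square inner_commute algebra_simps)
      then show ?thesis by (simp add: a_def algebra_simps)
    qed
    have a0: "0 \<le> a" using hom[OF w(1)] by (simp add: a_def)
    have "b\<^sup>2 = 0"
    proof -
      \<comment> \<open>The choice of \<open>t\<close> only needs \<open>t\<close> proportional to \<open>b\<close> and \<open>t * a < 2 * b\<close> for \<open>b > 0\<close>.\<close>
      have "2 * (b / (a + 1)) * b \<le> (b / (a + 1))\<^sup>2 * a" by (rule *)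
      then have "2 * b\<^sup>2 * (a + 1) \<le> b\<^sup>2 * a" using a0
        by (simp add: power2_eq_square divide_simps mult_ac split: if_splits)
      then have "b\<^sup>2 * (a + 2) \<le> 0" by (simp add: algebra_simps)
      then show ?thesis using a0 by (simp add: mult_le_0_iff)
    qed
    then show ?thesis by (simp add: b_def)
  qed
  define w where "w = A *v v - m *\<^sub>R v"
  have "w \<in> S" using S vS inv by (simp add: w_def subspace_diff subspace_scale)
  moreover have wv: "w \<bullet> v = 0" by (simp add: w_def inner_diff_left v1) (simp add: m_def inner_commute)
  ultimately have "w \<bullet> (A *v v) = 0" by (rule orth)
  then have "w \<bullet> w = 0" using wv by (simp add: w_def inner_diff_right)
  then have "A *v v = m *\<^sub>R v" by (simp add: w_def)
  then show ?thesis using vS v1 by (auto simp: norm_eq_1)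
qed

lemma symmetric_orthonormal_eigenbasis:
  fixes A :: "real^'n^'n"
  assumes sym: "transpose A = A" and S: "subspace S"
    and inv: "\<And>x. x \<in> S \<Longrightarrow> A *v x \<in> S"
  shows "\<exists>B\<subseteq>S. pairwise orthogonal B \<and> (\<forall>v\<in>B. norm v = 1 \<and> (\<exists>m. A *v v = m *\<^sub>R v)) \<and> S \<subseteq> span B"
  using S inv
proof (induction "dim S" arbitrary: S rule: less_induct)
  case less
  show ?case
  proof (cases "S = {0}")
    case True
    then show ?thesis by (intro exI[of _ "{}"]) auto
  next
    case False
    obtain v m where v: "v \<in> S" "norm v = 1" "A *v v = m *\<^sub>R v"
      using symmetric_eigenvector_exists[OF sym less.prems(1) False less.prems(2)] by blast
    define S' where "S' = {x \<in> S. v \<bullet> x = 0}"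
    have S': "subspace S'"
      using less.prems(1) by (auto simp: S'_def subspace_def inner_add_right)
    have vv: "v \<bullet> v = 1" using v by (simp add: norm_eq_1)
    have "v \<notin> S'" "S' \<subseteq> S" using vv by (auto simp: S'_def)
    then have "S' \<subset> S" using v(1) by blast
    then have "dim S' < dim S"
      by (metis S' less.prems(1) dim_psubset span_eq_iff)
    moreover have "A *v x \<in> S'" if "x \<in> S'" for x
      using that less.prems(2) symmetric_inner_matrix[OF sym, of v x] v by (auto simp: S'_def)
    ultimately obtain B where B: "B \<subseteq> S'" "pairwise orthogonal B"
      "\<forall>v\<in>B. norm v = 1 \<and> (\<exists>m. A *v v = m *\<^sub>R v)" "S' \<subseteq> span B"
      using less.hyps[of S'] S' by blast
    have "S \<subseteq> span (insert v B)"
    proof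
      fix x assume x: "x \<in> S"
      have "x - (v \<bullet> x) *\<^sub>R v \<in> S'"
        using x v vv less.prems(1) by (auto simp: S'_def inner_diff_right subspace_diff subspace_scale)
      then show "x \<in> span (insert v B)"
        using B(4) by (auto simp: span_insert)
    qed
    moreover have "pairwise orthogonal (insert v B)"
      using B(1,2) by (auto simp: pairwise_insert S'_def orthogonal_def inner_commute)
    ultimately show ?thesis
      using B v by (intro exI[of _ "insert v B"]) (auto simp: S'_def)
  qed
qed

definition diag_mat :: "('n \<Rightarrow> 'a::zero) \<Rightarrow> 'a^'n^'n" where
  "diag_mat l = (\<chi> i j. if i = j then l i else 0)"

text \<open>
  The spectral theorem; the rows of \<open>Q\<close> are the eigenvectors.
\<close>

theorem symmetric_diagonalization:
  fixes A :: "real^'n^'n"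
  assumes sym: "transpose A = A"
  obtains Q l where "orthogonal_matrix Q" "A = transpose Q ** diag_mat l ** Q"
    "\<And>i. A *v row i Q = l i *\<^sub>R row i Q"
proof -
  obtain B where B: "pairwise orthogonal B" "\<And>v. v \<in> B \<Longrightarrow> norm v = 1 \<and> (\<exists>m. A *v v = m *\<^sub>R v)"
      "UNIV \<subseteq> span B"
    using symmetric_orthonormal_eigenbasis[OF sym subspace_UNIV] by blast
  have "0 \<notin> B" using B(2)[of 0] by auto
  then have ind: "independent B" using B(1) by (rule pairwise_orthogonal_independent[rotated])
  have "card B = dim (UNIV :: (real^'n) set)"
    using ind B(3) by (intro basis_card_eq_dim) auto
  then have "card B = CARD('n)" by (simp add: dim_UNIV)
  moreover have "finite B" using ind by (rule independent_imp_finite)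
  ultimately obtain f where f: "bij_betw f (UNIV :: 'n set) B"
    by (metis finite_same_card_bij finite_class.finite_UNIV)
  have fB: "f i \<in> B" for i using f by (auto simp: bij_betw_def)
  have f1: "f i \<bullet> f i = 1" for i using B(2)[OF fB[of i]] by (simp add: norm_eq_1)
  have f0: "f i \<bullet> f j = 0" if "i \<noteq> j" for i j
    using B(1) fB[of i] fB[of j] f that by (auto simp: pairwise_def orthogonal_def bij_betw_def inj_on_def)
  obtain l where l: "\<And>i. A *v f i = l i *\<^sub>R f i" using B(2)[OF fB] by metis
  define Q :: "real^'n^'n" where "Q = (\<chi> i. f i)"
  have row: "row i Q = f i" for i by (simp add: row_def Q_def vec_eq_iff)
  have orth: "orthogonal_matrix Q"
    using f1 f0 by (simp add: orthogonal_matrix_orthonormal_rows row norm_eq_1 orthogonal_def)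
  have "Q ** A ** transpose Q = diag_mat l"
  proof -
    have "(Q ** (A ** transpose Q)) $ i $ j = f i \<bullet> (A *v f j)" for i j
      by (simp add: matrix_matrix_mult_def matrix_vector_mult_def inner_vec_def Q_def transpose_def)
    then show ?thesis
      using f0 f1 by (auto simp: vec_eq_iff diag_mat_def l matrix_mul_assoc[symmetric])
  qed
  then have "transpose Q ** diag_mat l ** Q = transpose Q ** (Q ** A ** transpose Q) ** Q"
    by simp
  also have "\<dots> = (transpose Q ** Q) ** A ** (transpose Q ** Q)"
    by (simp only: matrix_mul_assoc)
  finally have "transpose Q ** diag_mat l ** Q = (transpose Q ** Q) ** A ** (transpose Q ** Q)" .
  then have "A = transpose Q ** diag_mat l ** Q"
    using orth by (simp add: orthogonal_matrix_def)
  with orth show ?thesis using that l row by simp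
qed

lemma map_matrix_const_poly_mult:
  fixes A B :: "real^'n^'n"
  shows "map_matrix (\<lambda>x. [:x:]) (A ** B) = map_matrix (\<lambda>x. [:x:]) A ** map_matrix (\<lambda>x. [:x:]) B"
proof -
  have "[:sum g T:] = (\<Sum>k\<in>T. [:g k:])" if "finite T" for g :: "'n \<Rightarrow> real" and T
    using that
  proof (induction T rule: finite_induct)
    case (insert x T)
    then show ?case by (simp add: insert.IH[symmetric])
  qed simp
  then show ?thesis by (simp add: vec_eq_iff matrix_matrix_mult_def mult.commute)
qed

text \<open>
  Stated over a commutative ring, since it is applied to matrices of polynomials.
\<close>

lemma det_conjugate_diag_mat:
  fixes P :: "'a::comm_ring_1^'n^'n"
  assumes "transpose P ** P = mat 1"
  shows "det (mat c - transpose P ** diag_mat l ** P) = (\<Prod>i\<in>UNIV. c - l i)"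
proof -
  have comm: "transpose P ** mat c = mat c ** transpose P"
    by (simp add: vec_eq_iff matrix_matrix_mult_def mat_def if_distrib if_distribR mult.commute cong: if_cong)
  have "transpose P ** diag_mat (\<lambda>i. c - l i) ** P =
        transpose P ** mat c ** P - transpose P ** diag_mat l ** P"
    by (simp add: vec_eq_iff matrix_matrix_mult_def diag_mat_def mat_def if_distrib sum_subtractf[symmetric]
        algebra_simps cong: if_cong)
  also have "transpose P ** mat c ** P = mat c"
    by (simp add: comm matrix_mul_assoc[symmetric] assms)
  finally have "det (mat c - transpose P ** diag_mat l ** P) =
      det (transpose P ** P) * det (diag_mat (\<lambda>i. c - l i))"
    by (metis (no_types, lifting) det_mul mult.assoc mult.commute)
  also have "det (diag_mat (\<lambda>i. c - l i)) = (\<Prod>i\<in>UNIV. c - l i)"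
    by (subst det_diagonal) (auto simp: diag_mat_def)
  finally show ?thesis by (simp add: assms)
qed

lemma charpoly_conjugate_diag_mat:
  fixes Q :: "real^'n^'n"
  assumes "orthogonal_matrix Q"
  shows "charpoly (transpose Q ** diag_mat l ** Q) = (\<Prod>i\<in>UNIV. [:- l i, 1:])"
proof -
  define P where "P = map_matrix (\<lambda>x. [:x:]) Q"
  have tP: "map_matrix (\<lambda>x. [:x:]) (transpose Q) = transpose P"
    by (simp add: vec_eq_iff P_def transpose_def)
  have D: "map_matrix (\<lambda>x. [:x:]) (diag_mat l) = diag_mat (\<lambda>i. [:l i:])"
    by (simp add: vec_eq_iff diag_mat_def)
  have "transpose P ** P = map_matrix (\<lambda>x. [:x:]) (transpose Q ** Q)"
    by (simp add: map_matrix_const_poly_mult tP) (simp add: P_def)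
  also have "\<dots> = mat 1"
    using assms by (simp add: orthogonal_matrix_def vec_eq_iff mat_def one_pCons)
  finally have "transpose P ** P = mat 1" .
  moreover have "charpoly (transpose Q ** diag_mat l ** Q) =
      det (mat [:0, 1:] - transpose P ** diag_mat (\<lambda>i. [:l i:]) ** P)"
    by (simp add: charpoly_def map_matrix_const_poly_mult tP D P_def)
  ultimately show ?thesis by (simp add: det_conjugate_diag_mat)
qed

lemma proots_prod_linear:
  "proots (\<Prod>i\<in>(UNIV :: 'n::finite set). [:- l i, 1:]) = image_mset l (mset_set UNIV :: 'n multiset)"
proof -
  have "proots (\<Prod>i\<in>S. [:- l i, 1:]) = image_mset l (mset_set S)" if "finite S" for S :: "'n set"
    using that
  proof (induction S rule: finite_induct)
    case (insert x S)
    have "(\<Prod>i\<in>S. [:- l i, 1:]) \<noteq> 0" using insert by (simp add: prod_zero_iff)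
    then show ?case using insert by (simp add: proots_mult del: mult_pCons_left)
  qed simp
  then show ?thesis by simp
qed

text \<open>
  Turns the sorted list that defines the singular values into an enumeration of the index type, so that
  products of singular values become products over indices.
\<close>

lemma decreasing_enumeration:
  fixes g :: "'n::finite \<Rightarrow> real"
  obtains e where "bij_betw e {..<CARD('n)} (UNIV :: 'n set)"
    "\<And>k. k < CARD('n) \<Longrightarrow> rev (sorted_list_of_multiset (image_mset g (mset_set UNIV))) ! k = g (e k)"
    "\<And>j k. j \<le> k \<Longrightarrow> k < CARD('n) \<Longrightarrow> g (e k) \<le> g (e j)"
proof -
  obtain ds :: "'n list" where ds: "set ds = UNIV" "distinct ds"
    using finite_distinct_list[OF finite_class.finite_UNIV] by blast
  define es where "es = rev (sort_key g ds)"
  have es: "set es = UNIV" "distinct es" "length es = CARD('n)"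
    using ds distinct_card[of ds] by (auto simp: es_def)
  have "mset (map g (sort_key g ds)) = image_mset g (mset_set UNIV)"
    using ds by (metis mset_map mset_set_set mset_sort)
  then have "sorted_list_of_multiset (image_mset g (mset_set UNIV)) = map g (sort_key g ds)"
    by (metis sorted_list_of_multiset_mset properties_for_sort sorted_sort_key)
  then have rv: "rev (sorted_list_of_multiset (image_mset g (mset_set UNIV))) = map g es"
    by (simp add: es_def rev_map)
  have "sorted (rev (map g es))" by (simp add: es_def rev_map)
  show ?thesis
  proof (rule that[of "\<lambda>k. es ! k"])
    show "bij_betw (\<lambda>k. es ! k) {..<CARD('n)} UNIV"
      using bij_betw_nth[of es "{..<CARD('n)}" UNIV] es by simp
    show "rev (sorted_list_of_multiset (image_mset g (mset_set UNIV))) ! k = g (es ! k)"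
      if "k < CARD('n)" for k
      using that es by (simp add: rv)
    show "g (es ! k) \<le> g (es ! j)" if "j \<le> k" "k < CARD('n)" for j k
      using sorted_rev_nth_mono[OF \<open>sorted (rev (map g es))\<close> that(1)] that es by simp
  qed
qed

text \<open>
  The part of the singular value decomposition that is used: \<open>e\<close> lists the eigenvalues \<open>l\<close> of
  \<open>A\<^sup>T A\<close> in decreasing order.
\<close>

lemma singular_value_decomposition:
  fixes A :: "real^'d^'d"
  obtains Q l e where "orthogonal_matrix Q" "transpose A ** A = transpose Q ** diag_mat l ** Q"
    "\<And>i. 0 \<le> l i" "\<And>i. sqrt (l i) \<le> onorm ((*v) A)"
    "bij_betw e {..<CARD('d)} UNIV"
    "\<And>k. k < CARD('d) \<Longrightarrow> singular_value (Suc k) A = sqrt (l (e k))"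
    "\<And>j k. j \<le> k \<Longrightarrow> k < CARD('d) \<Longrightarrow> l (e k) \<le> l (e j)"
proof -
  have "transpose (transpose A ** A) = transpose A ** A" by (simp add: matrix_transpose_mul)
  then obtain Q l where Q: "orthogonal_matrix Q" "transpose A ** A = transpose Q ** diag_mat l ** Q"
    "\<And>i. (transpose A ** A) *v row i Q = l i *\<^sub>R row i Q"
    using symmetric_diagonalization by blast
  have l_norm: "l i = (norm (A *v row i Q))\<^sup>2" for i
  proof -
    have "norm (row i Q) = 1" using Q(1) by (simp add: orthogonal_matrix_orthonormal_rows)
    then have "row i Q \<bullet> ((transpose A ** A) *v row i Q) = l i"
      by (simp add: Q(3) dot_square_norm)
    moreover have "row i Q \<bullet> ((transpose A ** A) *v row i Q) = (A *v row i Q) \<bullet> (A *v row i Q)"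
      by (metis dot_lmul_matrix matrix_vector_mul_assoc transpose_matrix_vector transpose_transpose)
    ultimately show ?thesis by (simp add: dot_square_norm)
  qed
  have l0: "0 \<le> l i" for i by (simp add: l_norm)
  have lon: "sqrt (l i) \<le> onorm ((*v) A)" for i
  proof -
    have "norm (A *v row i Q) \<le> onorm ((*v) A) * norm (row i Q)"
      by (intro onorm matrix_vector_mul_bounded_linear)
    then show ?thesis
      using Q(1) by (simp add: l_norm orthogonal_matrix_orthonormal_rows)
  qed
  obtain e where e: "bij_betw e {..<CARD('d)} (UNIV :: 'd set)"
    "\<And>k. k < CARD('d) \<Longrightarrow> rev (sorted_list_of_multiset
        (image_mset (\<lambda>i. sqrt (l i)) (mset_set UNIV))) ! k = sqrt (l (e k))"
    "\<And>j k. j \<le> k \<Longrightarrow> k < CARD('d) \<Longrightarrow> sqrt (l (e k)) \<le> sqrt (l (e j))"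
    using decreasing_enumeration[of "\<lambda>i. sqrt (l i)"] by blast
  have "singular_values A = rev (sorted_list_of_multiset (image_mset (\<lambda>i. sqrt (l i)) (mset_set UNIV)))"
    by (simp add: singular_values_def Q(2) charpoly_conjugate_diag_mat[OF Q(1)] proots_prod_linear
        multiset.map_comp comp_def)
  then show ?thesis
    using that[OF Q(1,2) l0 lon e(1)] e(2,3) by (simp add: singular_value_def)
qed

lemma singular_value_nonneg:
  fixes A :: "real^'d^'d"
  assumes "k < CARD('d)" shows "0 \<le> singular_value (Suc k) A"
  using assms by (metis singular_value_decomposition real_sqrt_ge_0_iff)

lemma singular_value_le_onorm:
  fixes A :: "real^'d^'d"
  assumes "k < CARD('d)" shows "singular_value (Suc k) A \<le> onorm ((*v) A)"
  using assms by (metis singular_value_decomposition)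

lemma abs_det_eq_prod_singular_values:
  fixes A :: "real^'d^'d"
  shows "\<bar>det A\<bar> = (\<Prod>k<CARD('d). singular_value (Suc k) A)"
proof -
  obtain Q l e where Q: "orthogonal_matrix Q" "transpose A ** A = transpose Q ** diag_mat l ** Q"
    "\<And>i. 0 \<le> l i" "bij_betw e {..<CARD('d)} (UNIV :: 'd set)"
    "\<And>k. k < CARD('d) \<Longrightarrow> singular_value (Suc k) A = sqrt (l (e k))"
    using singular_value_decomposition[of A] by metis
  have "det Q * det Q = 1"
    using Q(1) by (metis det_I det_mul det_transpose orthogonal_matrix_def)
  moreover have "det (transpose A ** A) = (det Q * det Q) * det (diag_mat l)"
    unfolding Q(2) by (simp add: det_mul)
  ultimately have "(det A)\<^sup>2 = det (diag_mat l)"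
    by (simp add: det_mul power2_eq_square)
  also have "\<dots> = (\<Prod>i\<in>UNIV. l i)"
    by (subst det_diagonal) (auto simp: diag_mat_def)
  finally have "\<bar>det A\<bar> = sqrt (\<Prod>i\<in>UNIV. l i)" by (metis real_sqrt_abs)
  also have "\<dots> = (\<Prod>i\<in>UNIV. sqrt (l i))"
  proof -
    have "sqrt (\<Prod>i\<in>T. l i) = (\<Prod>i\<in>T. sqrt (l i))" for T
      by (induction T rule: infinite_finite_induct) (simp_all add: real_sqrt_mult)
    then show ?thesis .
  qed
  also have "\<dots> = (\<Prod>k<CARD('d). sqrt (l (e k)))"
    using prod.reindex_bij_betw[OF Q(4), of "\<lambda>i. sqrt (l i)"] by simp
  finally show ?thesis using Q(5) by simp
qed

section \<open>Tensor products of exterior powers\<close>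

text \<open>
  \<open>R\<close> is a set of tensor slots \<open>(j, r)\<close>, and \<open>j\<close> names the block of the slot.  The permutations that
  preserve every block form a Young subgroup of the symmetric group on \<open>R\<close>.
\<close>

definition young_perms :: "(nat \<times> nat) set \<Rightarrow> (nat \<times> nat \<Rightarrow> nat \<times> nat) set" where
  "young_perms R = {g. g permutes R \<and> (\<forall>r. fst (g r) = fst r)}"

definition tensor_index :: "(nat \<times> nat) set \<Rightarrow> (nat \<times> nat \<Rightarrow> 'd) set" where
  "tensor_index R = (\<Pi>\<^sub>E r\<in>R. UNIV)"

text \<open>
  The matrix of \<open>A\<close> on the tensor power indexed by \<open>R\<close>, composed with the projection onto the tensors
  that are antisymmetric within every block.  It is thus the tensor product over the blocks of the
  exterior powers of \<open>A\<close>, extended by zero.  Keeping the full tensor power as index set makes all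
  degrees and multiplicities instances of one formula over one index type.
\<close>

definition young_rep ::
  "(nat \<times> nat) set \<Rightarrow> real^'d^'d \<Rightarrow> (nat \<times> nat \<Rightarrow> 'd) \<Rightarrow> (nat \<times> nat \<Rightarrow> 'd) \<Rightarrow> real" where
  "young_rep R A I J =
     (\<Sum>g\<in>young_perms R. of_int (sign g) * (\<Prod>r\<in>R. A $ I r $ J (g r))) / real (card (young_perms R))"

lemma young_perms_id: "id \<in> young_perms R"
  by (simp add: young_perms_def permutes_id)

lemma young_perms_permutes: "g \<in> young_perms R \<Longrightarrow> g permutes R"
  by (simp add: young_perms_def)

lemma young_perms_fst: "g \<in> young_perms R \<Longrightarrow> fst (g r) = fst r"
  by (simp add: young_perms_def del: split_paired_All)

lemma finite_young_perms: "finite R \<Longrightarrow> finite (young_perms R)"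
  using finite_permutations by (rule finite_subset[rotated]) (auto simp: young_perms_def)

lemma card_young_perms_pos: "finite R \<Longrightarrow> card (young_perms R) > 0"
  using finite_young_perms young_perms_id card_gt_0_iff by blast

lemma young_perms_comp: "g \<in> young_perms R \<Longrightarrow> h \<in> young_perms R \<Longrightarrow> g \<circ> h \<in> young_perms R"
  by (simp add: young_perms_def permutes_compose del: split_paired_All)

lemma young_perms_inv: "g \<in> young_perms R \<Longrightarrow> inv g \<in> young_perms R"
  unfolding young_perms_def mem_Collect_eq by (metis permutes_inv permutes_inverses(1))

lemma young_perms_inv_comp:
  "g \<in> young_perms R \<Longrightarrow> g \<circ> inv g = id" "g \<in> young_perms R \<Longrightarrow> inv g \<circ> g = id"
  using permutes_inv_o[OF young_perms_permutes] by blast+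

lemma sum_young_perms_comp_right:
  assumes "g \<in> young_perms R"
  shows "(\<Sum>h\<in>young_perms R. T (h \<circ> g)) = (\<Sum>h\<in>young_perms R. T h)"
  using assms
  by (intro sum.reindex_bij_witness[where j = "\<lambda>h. h \<circ> g" and i = "\<lambda>h. h \<circ> inv g"])
     (simp_all add: young_perms_comp young_perms_inv comp_assoc young_perms_inv_comp)

lemma sum_young_perms_comp_left:
  assumes "g \<in> young_perms R"
  shows "(\<Sum>h\<in>young_perms R. T (g \<circ> h)) = (\<Sum>h\<in>young_perms R. T h)"
  using assms
  by (intro sum.reindex_bij_witness[where j = "\<lambda>h. g \<circ> h" and i = "\<lambda>h. inv g \<circ> h"])
     (simp_all add: young_perms_comp young_perms_inv comp_assoc[symmetric] young_perms_inv_comp)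

lemma sum_young_perms_inv: "(\<Sum>h\<in>young_perms R. T (inv h)) = (\<Sum>h\<in>young_perms R. T h)"
  by (intro sum.reindex_bij_witness[where j = inv and i = inv])
     (simp_all add: young_perms_inv permutes_inv_inv[OF young_perms_permutes])

lemma sign_young_perms_comp:
  assumes "finite R" "g \<in> young_perms R" "h \<in> young_perms R"
  shows "sign (g \<circ> h) = sign g * sign h"
  using assms by (intro sign_compose) (auto intro: young_perms_permutes permutes_imp_permutation)

lemma prod_young_perms:
  assumes "g \<in> young_perms R"
  shows "(\<Prod>r\<in>R. F (g r)) = (\<Prod>r\<in>R. F r)"
  using assms by (intro prod.reindex_bij_betw permutes_imp_bij) (simp add: young_perms_def)

lemma finite_tensor_index: "finite R \<Longrightarrow> finite (tensor_index R :: (nat \<times> nat \<Rightarrow> 'd::finite) set)"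
  by (simp add: tensor_index_def finite_PiE)

lemma tensor_index_nonempty: "tensor_index R \<noteq> {}"
  by (simp add: tensor_index_def PiE_eq_empty_iff)

lemma tensor_index_comp:
  "I \<in> tensor_index R \<Longrightarrow> g \<in> young_perms R \<Longrightarrow> I \<circ> g \<in> tensor_index R"
  by (auto simp: tensor_index_def PiE_def extensional_def permutes_not_in[OF young_perms_permutes])

lemma sum_tensor_index_comp:
  assumes "g \<in> young_perms R"
  shows "(\<Sum>K\<in>tensor_index R. T (K \<circ> g)) = (\<Sum>K\<in>tensor_index R. T K)"
  using assms young_perms_inv
  by (intro sum.reindex_bij_witness[where j = "\<lambda>K. K \<circ> g" and i = "\<lambda>K. K \<circ> inv g"])
     (simp_all add: tensor_index_comp comp_assoc young_perms_inv_comp)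

text \<open>
  Functoriality (the Cauchy--Binet formula).  The permutation \<open>g\<close> is absorbed by reindexing the summation variable
  \<open>K\<close>, after which the sum over \<open>K\<close> factors into matrix products slot by slot.
\<close>

lemma young_rep_mult:
  fixes A B :: "real^'d^'d"
  assumes R: "finite R"
  shows "young_rep R (A ** B) I J = (\<Sum>K\<in>tensor_index R. young_rep R A I K * young_rep R B K J)"
proof -
  let ?G = "young_perms R" and ?X = "tensor_index R :: (nat \<times> nat \<Rightarrow> 'd) set"
  define n where "n = real (card ?G)"
  have n: "n > 0" using card_young_perms_pos[OF R] by (simp add: n_def)
  define T where "T = (\<lambda>g. of_int (sign g) * (\<Prod>r\<in>R. (A ** B) $ I r $ J (g r)) :: real)"
  have key: "(\<Sum>K\<in>?X. (of_int (sign g) * (\<Prod>r\<in>R. A $ I r $ K (g r))) *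
               (of_int (sign h) * (\<Prod>r\<in>R. B $ K r $ J (h r)))) = T (h \<circ> g)"
    if g: "g \<in> ?G" and h: "h \<in> ?G" for g h
  proof -
    have "(\<Sum>K\<in>?X. (of_int (sign g) * (\<Prod>r\<in>R. A $ I r $ K (g r))) *
               (of_int (sign h) * (\<Prod>r\<in>R. B $ K r $ J (h r)))) =
          of_int (sign (h \<circ> g)) * (\<Sum>K\<in>?X. (\<Prod>r\<in>R. A $ I r $ K (g r)) * (\<Prod>r\<in>R. B $ K r $ J (h r)))"
      by (simp add: sign_young_perms_comp[OF R h g] sum_distrib_left mult_ac)
    also have "(\<Sum>K\<in>?X. (\<Prod>r\<in>R. A $ I r $ K (g r)) * (\<Prod>r\<in>R. B $ K r $ J (h r))) =
        (\<Sum>K\<in>?X. \<Prod>r\<in>R. A $ I r $ (K \<circ> g) r * B $ (K \<circ> g) r $ J ((h \<circ> g) r))"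
    proof (rule sum.cong[OF refl])
      fix K
      have "(\<Prod>r\<in>R. B $ K r $ J (h r)) = (\<Prod>r\<in>R. B $ K (g r) $ J (h (g r)))"
        using prod_young_perms[OF g, of "\<lambda>r. B $ K r $ J (h r)"] by simp
      then show "(\<Prod>r\<in>R. A $ I r $ K (g r)) * (\<Prod>r\<in>R. B $ K r $ J (h r)) =
          (\<Prod>r\<in>R. A $ I r $ (K \<circ> g) r * B $ (K \<circ> g) r $ J ((h \<circ> g) r))"
        by (simp add: prod.distrib)
    qed
    also have "\<dots> = (\<Sum>K\<in>?X. \<Prod>r\<in>R. A $ I r $ K r * B $ K r $ J ((h \<circ> g) r))"
      by (rule sum_tensor_index_comp[OF g])
    also have "\<dots> = (\<Prod>r\<in>R. \<Sum>k\<in>UNIV. A $ I r $ k * B $ k $ J ((h \<circ> g) r))"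
      unfolding tensor_index_def using R by (subst prod_sum_PiE) auto
    finally show ?thesis by (simp add: T_def matrix_matrix_mult_def comp_def)
  qed
  have "(\<Sum>K\<in>?X. young_rep R A I K * young_rep R B K J) =
      (\<Sum>K\<in>?X. \<Sum>g\<in>?G. \<Sum>h\<in>?G. (of_int (sign g) * (\<Prod>r\<in>R. A $ I r $ K (g r))) *
               (of_int (sign h) * (\<Prod>r\<in>R. B $ K r $ J (h r)))) / n\<^sup>2"
    unfolding young_rep_def n_def[symmetric]
    by (simp add: sum_product power2_eq_square sum_divide_distrib)
  also have "(\<Sum>K\<in>?X. \<Sum>g\<in>?G. \<Sum>h\<in>?G. (of_int (sign g) * (\<Prod>r\<in>R. A $ I r $ K (g r))) *
               (of_int (sign h) * (\<Prod>r\<in>R. B $ K r $ J (h r)))) =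
      (\<Sum>g\<in>?G. \<Sum>h\<in>?G. T (h \<circ> g))"
    by (subst sum.swap, intro sum.cong[OF refl], subst sum.swap, intro sum.cong[OF refl] key)
  also have "\<dots> = n * (\<Sum>h\<in>?G. T h)"
    by (simp add: sum_young_perms_comp_right n_def)
  also have "n * (\<Sum>h\<in>?G. T h) / n\<^sup>2 = young_rep R (A ** B) I J"
    using n by (simp add: young_rep_def T_def n_def power2_eq_square)
  finally show ?thesis by simp
qed

lemma young_rep_transpose:
  assumes R: "finite R"
  shows "young_rep R (transpose A) I J = young_rep R A J I"
proof -
  have "(\<Prod>r\<in>R. transpose A $ I r $ J (g r)) = (\<Prod>r\<in>R. A $ J r $ I (inv g r))"
    if g: "g \<in> young_perms R" for g
  proof -
    have "inv g (g r) = r" for r using permutes_inverses(2)[OF young_perms_permutes[OF g]] .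
    then show ?thesis
      using prod_young_perms[OF g, of "\<lambda>r. A $ J r $ I (inv g r)"] by (simp add: transpose_def)
  qed
  moreover have "sign g = sign (inv g)" if "g \<in> young_perms R" for g
    using that R by (subst sign_inverse) (auto intro: young_perms_permutes permutes_imp_permutation)
  ultimately have "(\<Sum>g\<in>young_perms R. of_int (sign g) * (\<Prod>r\<in>R. transpose A $ I r $ J (g r))) =
     (\<Sum>g\<in>young_perms R. of_int (sign (inv g)) * (\<Prod>r\<in>R. A $ J r $ I (inv g r)) :: real)"
    by (intro sum.cong[OF refl]) simp
  also have "\<dots> = (\<Sum>g\<in>young_perms R. of_int (sign g) * (\<Prod>r\<in>R. A $ J r $ I (g r)))"
    by (rule sum_young_perms_inv)
  finally show ?thesis by (simp add: young_rep_def)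
qed

lemma young_rep_trace_commute:
  fixes A B :: "real^'d^'d"
  assumes R: "finite R"
  shows "(\<Sum>I\<in>tensor_index R. young_rep R (A ** B) I I) = (\<Sum>I\<in>tensor_index R. young_rep R (B ** A) I I)"
  unfolding young_rep_mult[OF R] by (subst sum.swap) (simp add: mult.commute)

definition block_inj :: "(nat \<times> nat) set \<Rightarrow> (nat \<times> nat \<Rightarrow> 'd) \<Rightarrow> bool" where
  "block_inj R I \<longleftrightarrow> (\<forall>r\<in>R. \<forall>s\<in>R. fst r = fst s \<longrightarrow> I r = I s \<longrightarrow> r = s)"

text \<open>
  If \<open>I\<close> repeats a value within a block, the transposition of two such slots cancels the terms in pairs;
  otherwise only the identity permutation avoids the zeros of the diagonal matrix.
\<close>

lemma young_rep_diag_mat: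
  assumes R: "finite R"
  shows "young_rep R (diag_mat l) I I =
           (if block_inj R I then (\<Prod>r\<in>R. l (I r)) / real (card (young_perms R)) else 0)"
proof -
  define T where "T = (\<lambda>g. of_int (sign g) * (\<Prod>r\<in>R. diag_mat l $ I r $ I (g r)))"
  have "(\<Sum>g\<in>young_perms R. T g) = (if block_inj R I then (\<Prod>r\<in>R. l (I r)) else 0)"
  proof (cases "block_inj R I")
    case True
    have "T g = 0" if g: "g \<in> young_perms R" "g \<noteq> id" for g
    proof -
      have gp: "g permutes R" and gf: "\<And>r. fst (g r) = fst r" using g young_perms_permutes young_perms_fst by blast+
      obtain r where r: "g r \<noteq> r" using g(2) by fastforce
      then have rR: "r \<in> R" using permutes_not_in[OF gp] by blast
      then have "g r \<in> R" using gp by (simp add: permutes_in_image)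
      then have "I r \<noteq> I (g r)" using True rR r gf[of r] by (force simp: block_inj_def)
      then have "diag_mat l $ I r $ I (g r) = 0" by (simp add: diag_mat_def)
      then show ?thesis unfolding T_def using R rR by (auto intro!: prod_zero)
    qed
    then have "(\<Sum>g\<in>young_perms R. T g) = (\<Sum>g\<in>{id}. T g)"
      by (intro sum.mono_neutral_right finite_young_perms R) (auto simp: young_perms_id)
    then show ?thesis using True by (simp add: T_def diag_mat_def)
  next
    case False
    then obtain a b where ab: "a \<in> R" "b \<in> R" "fst a = fst b" "I a = I b" "a \<noteq> b"
      by (auto simp: block_inj_def)
    define t where "t = Transposition.transpose a b"
    have t: "t \<in> young_perms R"
      using ab by (simp add: young_perms_def t_def permutes_swap_id Transposition.transpose_def del: split_paired_All)
    have It: "I (t x) = I x" for x using ab by (auto simp: t_def Transposition.transpose_def)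
    have "T (t \<circ> g) = - T g" if g: "g \<in> young_perms R" for g
      using ab by (simp add: T_def sign_young_perms_comp[OF R t g] It) (simp add: t_def sign_swap_id)
    then have "(\<Sum>g\<in>young_perms R. T (t \<circ> g)) = - (\<Sum>g\<in>young_perms R. T g)"
      by (simp add: sum_negf)
    then show ?thesis using False by (simp add: sum_young_perms_comp_left[OF t])
  qed
  then show ?thesis by (simp add: young_rep_def T_def)
qed

text \<open>
  The squared Frobenius norm is the trace of the representation at \<open>A\<^sup>T A\<close>, and the trace does not see
  the conjugation by \<open>Q\<close>.
\<close>

lemma young_rep_frobenius:
  fixes A Q :: "real^'d^'d"
  assumes R: "finite R" and Q: "orthogonal_matrix Q" "transpose A ** A = transpose Q ** diag_mat l ** Q"
  shows "(\<Sum>I\<in>tensor_index R. \<Sum>J\<in>tensor_index R. (young_rep R A I J)\<^sup>2) * real (card (young_perms R)) =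
           (\<Sum>I | I \<in> tensor_index R \<and> block_inj R I. \<Prod>r\<in>R. l (I r))"
proof -
  let ?X = "tensor_index R :: (nat \<times> nat \<Rightarrow> 'd) set"
  have "(\<Sum>I\<in>?X. \<Sum>J\<in>?X. (young_rep R A I J)\<^sup>2) = (\<Sum>J\<in>?X. young_rep R (transpose A ** A) J J)"
    by (subst sum.swap) (simp add: young_rep_mult[OF R] young_rep_transpose[OF R] power2_eq_square)
  also have "\<dots> = (\<Sum>J\<in>?X. young_rep R (diag_mat l ** Q ** transpose Q) J J)"
    unfolding Q(2) matrix_mul_assoc[symmetric]
    by (subst young_rep_trace_commute[OF R]) (simp add: matrix_mul_assoc)
  also have "diag_mat l ** Q ** transpose Q = diag_mat l"
    using Q(1) by (simp add: matrix_mul_assoc[symmetric] orthogonal_matrix_def)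
  also have "(\<Sum>J\<in>?X. young_rep R (diag_mat l) J J) =
      (\<Sum>J\<in>?X. if block_inj R J then (\<Prod>r\<in>R. l (J r)) / real (card (young_perms R)) else 0)"
    by (simp add: young_rep_diag_mat[OF R])
  also have "\<dots> = (\<Sum>I | I \<in> ?X \<and> block_inj R I. \<Prod>r\<in>R. l (I r)) / real (card (young_perms R))"
    unfolding sum_divide_distrib by (rule sum.inter_filter[symmetric]) (rule finite_tensor_index[OF R])
  finally show ?thesis using card_young_perms_pos[OF R] by simp
qed

lemma prod_le_prod_initial:
  fixes a :: "nat \<Rightarrow> real"
  assumes a: "\<And>i. i < d \<Longrightarrow> 0 \<le> a i" "\<And>i j. i \<le> j \<Longrightarrow> j < d \<Longrightarrow> a j \<le> a i"
    and J: "J \<subseteq> {..<d}" "card J = k"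
  shows "(\<Prod>j\<in>J. a j) \<le> (\<Prod>r<k. a r)"
  using J
proof (induction k arbitrary: J)
  case 0
  then have "J = {}" using finite_subset[of J "{..<d}"] by simp
  then show ?case by simp
next
  case (Suc k)
  have fin: "finite J" and ne: "J \<noteq> {}" using Suc.prems finite_subset[of J "{..<d}"] by auto
  define M where "M = Max J"
  have M: "M \<in> J" using fin ne by (simp add: M_def)
  have "J \<subseteq> {..M}" using fin by (auto simp: M_def)
  then have "card J \<le> Suc M" using card_mono[of "{..M}" J] by simp
  then have "k \<le> M" using Suc.prems by simp
  have Md: "M < d" using M Suc.prems by auto
  have "(\<Prod>j\<in>J. a j) = a M * (\<Prod>j\<in>J - {M}. a j)" by (rule prod.remove[OF fin M])
  also have "\<dots> \<le> a k * (\<Prod>r<k. a r)"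
  proof (intro mult_mono)
    show "a M \<le> a k" using a(2) \<open>k \<le> M\<close> Md by simp
    show "(\<Prod>j\<in>J - {M}. a j) \<le> (\<Prod>r<k. a r)"
      using Suc.prems M fin by (intro Suc.IH) auto
    show "0 \<le> a k" using a(1) \<open>k \<le> M\<close> Md by simp
    show "0 \<le> (\<Prod>j\<in>J - {M}. a j)" using a(1) Suc.prems by (auto intro!: prod_nonneg)
  qed
  finally show ?case by (simp add: mult.commute)
qed

definition young_norm :: "(nat \<times> nat) set \<Rightarrow> real^'d^'d \<Rightarrow> real" where
  "young_norm R A = mat_norm1 (tensor_index R) (young_rep R A)"

text \<open>
  Up to a constant the squared Frobenius norm is a sum of squared products of singular values, with distinct indices within each
  block.  The largest term takes the first \<open>k j\<close> singular values in block \<open>j\<close>; it occurs in the sum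
  and bounds the other terms.
\<close>

theorem young_norm_comparable:
  fixes k :: "nat \<Rightarrow> nat" and q :: nat
  assumes k: "\<And>j. k j \<le> CARD('d)"
  defines "R \<equiv> SIGMA j:{..<q}. {..<k j}"
  shows "\<exists>c>0. \<forall>A :: real^'d^'d.
           (\<Prod>j<q. \<Prod>r<k j. singular_value (Suc r) A) \<le> c * young_norm R A \<and>
           young_norm R A \<le> c * (\<Prod>j<q. \<Prod>r<k j. singular_value (Suc r) A)"
proof -
  have R: "finite R" by (simp add: R_def)
  let ?X = "tensor_index R :: (nat \<times> nat \<Rightarrow> 'd) set"
  define n where "n = real (card (young_perms R))"
  define x where "x = real (card ?X)"
  have n: "n \<ge> 1" using card_young_perms_pos[OF R] by (simp add: n_def)
  have x: "x \<ge> 1" using finite_tensor_index[OF R] tensor_index_nonempty[of R]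
    by (auto simp: x_def Suc_le_eq card_gt_0_iff)
  have "(\<Prod>j<q. \<Prod>r<k j. singular_value (Suc r) A) \<le> sqrt n * young_norm R A \<and>
        young_norm R A \<le> x\<^sup>2 * (\<Prod>j<q. \<Prod>r<k j. singular_value (Suc r) A)" for A :: "real^'d^'d"
  proof -
    obtain Q l e where Q: "orthogonal_matrix Q" "transpose A ** A = transpose Q ** diag_mat l ** Q"
      and l0: "\<And>i. 0 \<le> l i" and e: "bij_betw e {..<CARD('d)} (UNIV :: 'd set)"
      and sv: "\<And>k. k < CARD('d) \<Longrightarrow> singular_value (Suc k) A = sqrt (l (e k))"
      and dec: "\<And>j k. j \<le> k \<Longrightarrow> k < CARD('d) \<Longrightarrow> l (e k) \<le> l (e j)"
      using singular_value_decomposition[of A] by metis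
    define P where "P = (\<Prod>j<q. \<Prod>r<k j. singular_value (Suc r) A)"
    define F where "F = (\<Sum>I\<in>?X. \<Sum>J\<in>?X. (young_rep R A I J)\<^sup>2)"
    define N where "N = young_norm R A"
    have lt: "r < CARD('d)" if "r < k j" for r j using that k[of j] by simp
    have P0: "0 \<le> P" unfolding P_def by (intro prod_nonneg) (auto simp: singular_value_nonneg lt)
    have N0: "0 \<le> N" by (simp add: N_def young_norm_def mat_norm1_nonneg)
    have PS: "(\<Prod>j<q. \<Prod>r<k j. G j r) = (\<Prod>r\<in>R. G (fst r) (snd r))" for G :: "nat \<Rightarrow> nat \<Rightarrow> real"
      unfolding R_def by (subst prod.Sigma) (auto simp: case_prod_unfold)
    have P2: "P\<^sup>2 = (\<Prod>j<q. \<Prod>r<k j. l (e r))"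
      unfolding P_def prod_power_distrib using sv lt l0 by simp
    have F: "F * n = (\<Sum>I | I \<in> ?X \<and> block_inj R I. \<Prod>r\<in>R. l (I r))"
      unfolding F_def n_def by (rule young_rep_frobenius[OF R Q])
    have term_le: "(\<Prod>r\<in>R. l (I r)) \<le> P\<^sup>2" if I: "block_inj R I" for I
    proof -
      have "(\<Prod>r<k j. l (I (j, r))) \<le> (\<Prod>r<k j. l (e r))" if j: "j < q" for j
      proof -
        define f where "f = (\<lambda>r. the_inv_into {..<CARD('d)} e (I (j, r)))"
        have ef: "e (f r) = I (j, r)" "f r < CARD('d)" for r
        proof -
          have inj: "inj_on e {..<CARD('d)}" and im: "I (j, r) \<in> e ` {..<CARD('d)}"
            using e by (auto simp: bij_betw_def)
          show "e (f r) = I (j, r)" unfolding f_def by (rule f_the_inv_into_f[OF inj im])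
          show "f r < CARD('d)" using the_inv_into_into[OF inj im, of "{..<CARD('d)}"] by (simp add: f_def)
        qed
        have inj: "inj_on f {..<k j}"
        proof (rule inj_onI)
          fix r s assume rs: "r \<in> {..<k j}" "s \<in> {..<k j}" "f r = f s"
          then have "I (j, r) = I (j, s)" by (metis ef(1))
          then show "r = s" using I rs j by (force simp: block_inj_def R_def)
        qed
        have "(\<Prod>r<k j. l (I (j, r))) = (\<Prod>i\<in>f ` {..<k j}. l (e i))"
          using inj by (simp add: prod.reindex ef)
        also have "\<dots> \<le> (\<Prod>r<k j. l (e r))"
          using ef(2) inj l0 dec by (intro prod_le_prod_initial[of "CARD('d)"]) (auto simp: card_image)
        finally show ?thesis .
      qed
      then have "(\<Prod>j<q. \<Prod>r<k j. l (I (j, r))) \<le> P\<^sup>2"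
        unfolding P2 using l0 by (intro prod_mono) (auto intro!: prod_nonneg)
      then show ?thesis by (simp add: PS)
    qed
    have Fle: "F * n \<le> x * P\<^sup>2"
    proof -
      have "F * n \<le> real (card {I. I \<in> ?X \<and> block_inj R I}) * P\<^sup>2"
        unfolding F by (rule sum_bounded_above) (simp add: term_le)
      also have "\<dots> \<le> x * P\<^sup>2"
        unfolding x_def using finite_tensor_index[OF R]
        by (intro mult_right_mono of_nat_mono card_mono) auto
      finally show ?thesis .
    qed
    have Fge: "P\<^sup>2 \<le> F * n"
    proof -
      define I0 where "I0 = restrict (\<lambda>r. e (snd r)) R"
      have "I0 \<in> ?X" by (simp add: I0_def tensor_index_def)
      moreover have "block_inj R I0"
        using bij_betw_imp_inj_on[OF e] lt
        by (auto simp: block_inj_def I0_def R_def inj_on_def)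
      moreover have P2I: "P\<^sup>2 = (\<Prod>r\<in>R. l (I0 r))"
        unfolding P2 PS by (simp add: I0_def)
      ultimately show ?thesis
        unfolding F using finite_tensor_index[OF R] l0
        by (subst P2I) (intro member_le_sum, auto intro!: prod_nonneg)
    qed
    have FX: "F = (\<Sum>z\<in>?X \<times> ?X. \<bar>young_rep R A (fst z) (snd z)\<bar>\<^sup>2)"
      unfolding F_def by (simp add: sum.cartesian_product case_prod_unfold)
    have NX: "N = (\<Sum>z\<in>?X \<times> ?X. \<bar>young_rep R A (fst z) (snd z)\<bar>)"
      unfolding N_def young_norm_def mat_norm1_def by (simp add: sum.cartesian_product case_prod_unfold)
    have "F \<le> N\<^sup>2"
      unfolding FX NX using finite_tensor_index[OF R]
      by (simp add: power2_eq_square sum_product)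
         (intro sum_mono order_trans[OF _ member_le_sum], auto)
    have "P\<^sup>2 \<le> (sqrt n * N)\<^sup>2"
    proof -
      have "P\<^sup>2 \<le> N\<^sup>2 * n" using Fge \<open>F \<le> N\<^sup>2\<close> n by (intro order_trans[OF Fge] mult_right_mono) auto
      then show ?thesis using n by (simp add: power_mult_distrib mult.commute)
    qed
    then have 1: "P \<le> sqrt n * N" by (rule power2_le_imp_le) (use N0 n in simp)
    have "N\<^sup>2 \<le> real (card (?X \<times> ?X)) * F"
      unfolding FX NX by (intro order_trans[OF sum_squared_le_sum_of_squares]) (auto simp: mult.commute)
    also have "\<dots> = x\<^sup>2 * F" by (simp add: x_def card_cartesian_product power2_eq_square)
    also have "\<dots> \<le> x\<^sup>2 * (F * n)"
    proof -
      have "0 \<le> F" by (simp add: F_def sum_nonneg)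
      then show ?thesis using n by (intro mult_left_mono) (auto simp: mult_le_cancel_left1)
    qed
    also have "\<dots> \<le> x\<^sup>2 * (x * P\<^sup>2)" using Fle by (intro mult_left_mono) auto
    also have "\<dots> \<le> x\<^sup>2 * (x\<^sup>2 * P\<^sup>2)"
      using x by (intro mult_left_mono mult_right_mono) (auto simp: power2_eq_square)
    also have "\<dots> = (x\<^sup>2 * P)\<^sup>2" by (simp add: power_mult_distrib power2_eq_square mult_ac)
    finally have "N \<le> x\<^sup>2 * P" by (rule power2_le_imp_le) (use P0 in simp)
    with 1 show ?thesis by (simp add: P_def N_def)
  qed
  note b = this
  show ?thesis
  proof (intro exI[of _ "sqrt n + x\<^sup>2"] conjI allI)
    show "0 < sqrt n + x\<^sup>2" using n x by (simp add: add_pos_nonneg)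
    fix A :: "real^'d^'d"
    have "0 \<le> young_norm R A" by (simp add: young_norm_def mat_norm1_nonneg)
    then have "sqrt n * young_norm R A \<le> (sqrt n + x\<^sup>2) * young_norm R A" by (intro mult_right_mono) auto
    then show "(\<Prod>j<q. \<Prod>r<k j. singular_value (Suc r) A) \<le> (sqrt n + x\<^sup>2) * young_norm R A"
      using b[of A] by linarith
    have "0 \<le> (\<Prod>j<q. \<Prod>r<k j. singular_value (Suc r) A)"
      using k by (intro prod_nonneg ballI singular_value_nonneg) (auto intro: less_le_trans)
    then have "x\<^sup>2 * (\<Prod>j<q. \<Prod>r<k j. singular_value (Suc r) A) \<le>
        (sqrt n + x\<^sup>2) * (\<Prod>j<q. \<Prod>r<k j. singular_value (Suc r) A)"
      using n by (intro mult_right_mono) auto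
    then show "young_norm R A \<le> (sqrt n + x\<^sup>2) * (\<Prod>j<q. \<Prod>r<k j. singular_value (Suc r) A)"
      using b[of A] by linarith
  qed
qed

section \<open>Growth rates and the sign of the pressure\<close>

text \<open>
  Fekete's lemma, with values in the extended reals so that the limit may be \<open>-\<infinity>\<close>.
\<close>

lemma fekete_ereal:
  fixes u :: "nat \<Rightarrow> real"
  assumes sub: "\<And>m n. u (m + n) \<le> u m + u n"
  shows "(\<lambda>n. ereal (u n / n)) \<longlonglongrightarrow> (INF n\<in>{1..}. ereal (u n / n))"
proof (rule order_tendstoI)
  fix a :: ereal assume "a < (INF n\<in>{1..}. ereal (u n / n))"
  then have "a < ereal (u n / n)" if "n \<ge> 1" for n
    using that by (meson INF_lower atLeast_iff less_le_trans)
  then show "\<forall>\<^sub>F n in sequentially. a < ereal (u n / n)"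
    by (rule eventually_sequentiallyI)
next
  fix a :: ereal assume "(INF n\<in>{1..}. ereal (u n / n)) < a"
  then obtain m where m: "m \<ge> 1" "ereal (u m / m) < a" by (auto simp: INF_less_iff)
  obtain b where b: "u m / m < b" "ereal b < a"
    using ereal_dense2[OF m(2)] by auto
  define C where "C = (\<Sum>r<m. \<bar>u r\<bar>) + \<bar>u m\<bar>"
  have mult: "u (q * m + r) \<le> q * u m + u r" for q r
  proof (induction q)
    case (Suc q)
    have "u (Suc q * m + r) = u (m + (q * m + r))" by (simp add: add.assoc)
    also have "\<dots> \<le> u m + u (q * m + r)" by (rule sub)
    finally show ?case using Suc by (simp add: algebra_simps)
  qed simp
  have bound: "u n \<le> n * (u m / m) + C" for n
  proof -
    define q r where "q = n div m" and "r = n mod m"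
    have n: "n = q * m + r" by (simp add: q_def r_def)
    have r: "r < m" using m by (simp add: r_def)
    have "u n \<le> q * u m + u r" unfolding n by (rule mult)
    also have "q * u m = n * (u m / m) - (r / m) * u m"
      using m by (simp add: n field_simps)
    also have "- ((r / m) * u m) \<le> \<bar>u m\<bar>"
    proof -
      have "\<bar>(r / m) * u m\<bar> \<le> 1 * \<bar>u m\<bar>"
        unfolding abs_mult using r by (intro mult_right_mono) auto
      then show ?thesis by linarith
    qed
    then have "n * (u m / m) - (r / m) * u m \<le> n * (u m / m) + \<bar>u m\<bar>" by simp
    moreover have "u r \<le> (\<Sum>r<m. \<bar>u r\<bar>)"
      using r member_le_sum[of r "{..<m}" "\<lambda>r. \<bar>u r\<bar>"] by auto
    ultimately show ?thesis unfolding C_def by linarith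
  qed
  have "(\<lambda>n. u m / m + C / real n) \<longlonglongrightarrow> u m / m + 0"
    by (intro tendsto_intros lim_const_over_n)
  then have "\<forall>\<^sub>F n in sequentially. u m / m + C / real n < b"
    using b by (auto dest: order_tendstoD)
  then show "\<forall>\<^sub>F n in sequentially. ereal (u n / n) < a"
    using eventually_ge_at_top[of 1]
  proof eventually_elim
    case (elim n)
    have "u n / n \<le> u m / m + C / n" using bound[of n] elim by (simp add: field_simps)
    also have "\<dots> < b" using elim by simp
    finally have "ereal (u n / n) < ereal b" by simp
    then show ?case using b(2) by (rule less_trans)
  qed
qed

text \<open>
  The sequence \<open>b\<close> is only comparable to a submultiplicative one, which determines the limit but not the
  individual terms; therefore the sign of the limit is read off from \<open>a\<close>.  If some \<open>a n\<close> vanishes,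
  so do all later terms and the limit is \<open>-\<infinity>\<close>.
\<close>

lemma growth_rate_exists:
  fixes a b :: "nat \<Rightarrow> real"
  assumes a0: "\<And>n. 0 \<le> a n" and sub: "\<And>m n. a (m + n) \<le> a m * a n"
    and c: "c > 0" and ab: "\<And>n. a n \<le> c * b n" and ba: "\<And>n. b n \<le> c * a n"
  shows "\<exists>L. (\<lambda>n. ereal (1 / real n) * elog (b n)) \<longlonglongrightarrow> L \<and> (L < 0 \<longleftrightarrow> (\<exists>n\<ge>1. a n < 1))"
proof (cases "\<exists>n\<ge>1. a n = 0")
  case True
  then obtain n0 where n0: "n0 \<ge> 1" "a n0 = 0" by blast
  have "ereal (1 / real n) * elog (b n) = - \<infinity>" if n: "n \<ge> n0" for n
  proof -
    have "a n \<le> a n0 * a (n - n0)" using sub[of n0 "n - n0"] n by simp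
    then have "a n = 0" using a0[of n] n0 by simp
    then have "b n = 0" using ab[of n] ba[of n] c by (simp add: zero_le_mult_iff)
    then show ?thesis using n n0 by (simp add: elog_def)
  qed
  then have "(\<lambda>n. ereal (1 / real n) * elog (b n)) \<longlonglongrightarrow> - \<infinity>"
    by (intro tendsto_eventually eventually_sequentiallyI)
  moreover have "\<exists>n\<ge>1. a n < 1" using n0 by (intro exI[of _ n0]) auto
  ultimately show ?thesis by (intro exI[of _ "- \<infinity>"]) auto
next
  case False
  then have pos1: "0 < a n" if "n \<ge> 1" for n using that a0[of n] by (metis less_eq_real_def)
  have "0 < a 0" using sub[of 0 1] pos1[of 1] a0[of 0] by (cases "a 0 = 0") auto
  then have pos: "0 < a n" for n using pos1[of n] by (cases n) auto
  have bpos: "0 < b n" for n using ab[of n] pos[of n] c by (metis less_le_trans zero_less_mult_pos)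
  define u where "u = (\<lambda>n. ln (a n))"
  have "u (m + n) \<le> u m + u n" for m n
    unfolding u_def ln_mult_pos[OF pos pos, symmetric] using sub[of m n] pos by (simp add: ln_le_cancel_iff)
  from fekete_ereal[of u, OF this]
  have lim: "(\<lambda>n. ereal (u n / n)) \<longlonglongrightarrow> (INF n\<in>{1..}. ereal (u n / n))" (is "_ \<longlonglongrightarrow> ?L") .
  have "(\<lambda>n. (ln (b n) - u n) / n) \<longlonglongrightarrow> 0"
  proof (rule Lim_null_comparison[OF _ lim_const_over_n[of "\<bar>ln c\<bar>"]])
    show "\<forall>\<^sub>F n in sequentially. norm ((ln (b n) - u n) / real n) \<le> \<bar>ln c\<bar> / real n"
    proof (rule always_eventually, rule allI)
      fix n
      have "ln (b n) \<le> ln (c * a n)" using ba[of n] bpos[of n] by simp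
      moreover have "u n \<le> ln (c * b n)" unfolding u_def using ab[of n] pos[of n] by simp
      ultimately have "\<bar>ln (b n) - u n\<bar> \<le> \<bar>ln c\<bar>"
        using ln_mult_pos[OF c pos[of n]] ln_mult_pos[OF c bpos[of n]] by (simp add: u_def)
      then show "norm ((ln (b n) - u n) / real n) \<le> \<bar>ln c\<bar> / real n"
        by (simp add: divide_right_mono)
    qed
  qed
  then have "(\<lambda>n. ereal ((ln (b n) - u n) / n)) \<longlonglongrightarrow> ereal 0" by simp
  from tendsto_add_ereal_general1[OF _ lim this]
  have "(\<lambda>n. ereal (u n / n) + ereal ((ln (b n) - u n) / n)) \<longlonglongrightarrow> ?L" by simp
  also have "(\<lambda>n. ereal (u n / n) + ereal ((ln (b n) - u n) / n)) = (\<lambda>n. ereal (1 / real n) * elog (b n))"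
  proof
    fix n
    show "ereal (u n / n) + ereal ((ln (b n) - u n) / n) = ereal (1 / real n) * elog (b n)"
      using bpos[of n] by (simp add: elog_def diff_divide_distrib)
  qed
  finally have "(\<lambda>n. ereal (1 / real n) * elog (b n)) \<longlonglongrightarrow> ?L" .
  moreover have "?L < 0 \<longleftrightarrow> (\<exists>n\<ge>1. a n < 1)"
  proof -
    have "ereal (u n / n) < 0 \<longleftrightarrow> a n < 1" if "n \<ge> 1" for n
      using that pos[of n] by (simp add: u_def divide_less_0_iff)
    then show ?thesis by (auto simp: INF_less_iff)
  qed
  ultimately show ?thesis by blast
qed

definition comparable :: "('a \<Rightarrow> real) \<Rightarrow> ('a \<Rightarrow> real) \<Rightarrow> bool" where
  "comparable f g \<longleftrightarrow> (\<exists>c>0. \<forall>x. f x \<le> c * g x \<and> g x \<le> c * f x)"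

text \<open>
  Nonnegativity and continuity are included, as they are always needed together with submultiplicativity.
\<close>

definition submultiplicative :: "(real^'d^'d \<Rightarrow> real) \<Rightarrow> bool" where
  "submultiplicative f \<longleftrightarrow> (\<forall>A. 0 \<le> f A) \<and> (\<forall>A B. f (A ** B) \<le> f A * f B) \<and> continuous_on UNIV f"

definition word_sum :: "(real^'d^'d \<Rightarrow> real) \<Rightarrow> real^'d^'d^'N \<Rightarrow> nat \<Rightarrow> real" where
  "word_sum f A n = (\<Sum>w | length w = n. f (word_prod A w))"

lemma word_prod_append: "word_prod A (u @ v) = word_prod A u ** word_prod A v"
  by (induction u) (simp_all add: word_prod_def matrix_mul_assoc[symmetric])

lemma word_sum_nonneg: "(\<And>M. 0 \<le> f M) \<Longrightarrow> 0 \<le> word_sum f A n"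
  by (simp add: word_sum_def sum_nonneg)

lemma word_sum_add_le:
  assumes "submultiplicative f"
  shows "word_sum f A (m + n) \<le> word_sum f A m * word_sum f A n"
  using assms
  by (simp add: word_sum_def sum_words_add word_prod_append sum_product submultiplicative_def sum_mono)

lemma comparable_word_sum:
  assumes "comparable f g"
  shows "comparable (word_sum f A) (word_sum g A)"
  using assms unfolding comparable_def word_sum_def sum_distrib_left
  by (meson sum_mono)

lemma pressure_neg_iff:
  fixes A :: "real^'d^'d^'N" and f :: "real^'d^'d \<Rightarrow> real"
  assumes f: "submultiplicative f" and cmp: "comparable (svf s) f"
  shows "pressure A s < 0 \<longleftrightarrow> (\<exists>n\<ge>1. word_sum f A n < 1)"
proof -
  obtain c where c: "c > 0" "\<And>n. word_sum (svf s) A n \<le> c * word_sum f A n"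
    "\<And>n. word_sum f A n \<le> c * word_sum (svf s) A n"
    using comparable_word_sum[OF cmp, of A] unfolding comparable_def by blast
  have "0 \<le> word_sum f A n" for n
    using f by (intro word_sum_nonneg) (simp add: submultiplicative_def)
  from growth_rate_exists[OF this word_sum_add_le[OF f] c(1) c(3) c(2)]
  obtain L where L: "(\<lambda>n. ereal (1 / real n) * elog (word_sum (svf s) A n)) \<longlonglongrightarrow> L"
    "L < 0 \<longleftrightarrow> (\<exists>n\<ge>1. word_sum f A n < 1)" by blast
  have "pressure A s = L"
    using limI[OF L(1)] by (simp add: pressure_def word_sum_def)
  then show ?thesis using L(2) by simp
qed

lemma word_sum_mult_le:
  assumes f: "submultiplicative f"
  shows "word_sum f A (m * q + r) \<le> word_sum f A m ^ q * word_sum f A r"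
proof (induction q)
  case (Suc q)
  have "word_sum f A (m * Suc q + r) \<le> word_sum f A m * word_sum f A (m * q + r)"
    using word_sum_add_le[OF f, of A m "m * q + r"] by (simp add: add.assoc)
  also have "\<dots> \<le> word_sum f A m * (word_sum f A m ^ q * word_sum f A r)"
    using f Suc by (intro mult_left_mono word_sum_nonneg) (auto simp: submultiplicative_def)
  finally show ?case by (simp add: mult_ac)
qed simp

lemma word_sum_exponential_decay:
  assumes f: "submultiplicative f" and m: "m \<ge> 1" "word_sum f A m < 1"
  shows "\<exists>C>0. \<exists>x. 0 < x \<and> x < 1 \<and> (\<forall>n. word_sum f A n \<le> C * x ^ n)"
proof -
  have f0: "0 \<le> word_sum f A n" for n
    using f by (intro word_sum_nonneg) (simp add: submultiplicative_def)
  define y where "y = max (1 / 2) (word_sum f A m)"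
  have y: "0 < y" "y < 1" "word_sum f A m \<le> y" using m by (auto simp: y_def)
  define x where "x = root m y"
  have x: "0 < x" "x < 1" "x ^ m = y"
    using y m by (auto simp: x_def)
  define C where "C = ((\<Sum>r<m. word_sum f A r) + 1) / x ^ m"
  have "word_sum f A n \<le> C * x ^ n" for n
  proof -
    define q r where "q = n div m" and "r = n mod m"
    have n: "n = m * q + r" and r: "r < m" using m by (simp_all add: q_def r_def)
    have "word_sum f A n \<le> word_sum f A m ^ q * word_sum f A r"
      unfolding n by (rule word_sum_mult_le[OF f])
    also have "\<dots> \<le> y ^ q * (\<Sum>r<m. word_sum f A r)"
      using y r f0 by (intro mult_mono power_mono member_le_sum) (auto intro!: sum_nonneg)
    also have "\<dots> \<le> y ^ q * ((\<Sum>r<m. word_sum f A r) + 1)"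
      using y by (intro mult_left_mono) auto
    also have "y ^ q = x ^ (m * q + r) / x ^ r" using x by (simp add: power_add power_mult)
    also have "\<dots> \<le> x ^ (m * q + r) / x ^ m"
      using x r by (intro divide_left_mono power_decreasing) auto
    finally show ?thesis
      using f0 by (simp add: C_def n mult_ac mult_right_mono sum_nonneg)
  qed
  moreover have "C > 0" unfolding C_def using x f0 by (intro divide_pos_pos add_nonneg_pos) (auto intro!: sum_nonneg)
  ultimately show ?thesis using x by blast
qed

section \<open>Models of the singular value function\<close>

lemma rpow_nonneg [simp]: "0 \<le> rpow x t"
  by (simp add: rpow_def)

lemma rpow_0 [simp]: "rpow x 0 = 1"
  by (simp add: rpow_def)

lemma rpow_1 [simp]: "0 \<le> x \<Longrightarrow> rpow x 1 = x"
  by (simp add: rpow_def)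

lemma rpow_add: "0 \<le> s \<Longrightarrow> 0 \<le> t \<Longrightarrow> rpow x (s + t) = rpow x s * rpow x t"
  by (auto simp: rpow_def powr_add)

lemma rpow_mult: "rpow (x * y) t = rpow x t * rpow y t"
  by (simp add: rpow_def powr_mult)

lemma rpow_mono: "0 \<le> t \<Longrightarrow> 0 \<le> x \<Longrightarrow> x \<le> y \<Longrightarrow> rpow x t \<le> rpow y t"
  by (auto simp: rpow_def powr_mono2)

lemma rpow_power_root:
  assumes "0 \<le> z" "0 < q"
  shows "rpow (z ^ b) (1 / real q) = rpow z (real b / real q)"
proof (cases "z = 0 \<or> b = 0")
  case True
  then show ?thesis using assms by (auto simp: rpow_def power_0_left)
next
  case False
  then have "z ^ b = z powr b" using assms by (simp add: powr_realpow)
  then show ?thesis using False assms by (simp add: rpow_def powr_powr)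
qed

text \<open>
  The exponents for which \<open>\<phi>\<^sup>s\<close> is the product of the powers of all singular values, both below and
  above the dimension.  They are nondecreasing in \<open>s\<close> and add up to \<open>s\<close>.
\<close>

definition sv_exponent :: "nat \<Rightarrow> real \<Rightarrow> nat \<Rightarrow> real" where
  "sv_exponent d s i = (if s < real d then max 0 (min 1 (s - real i)) else s / real d)"

lemma sum_sv_exponent:
  assumes "d > 0" "0 \<le> s" shows "(\<Sum>i<d. sv_exponent d s i) = s"
proof -
  have "(\<Sum>i<n. max 0 (min 1 (s - real i))) = max 0 (min (real n) s)" for n
    by (induction n) (use assms in \<open>auto simp: max_def min_def\<close>)
  from this[of d] show ?thesis
    using assms by (cases "s < real d") (simp_all add: sv_exponent_def)
qed

lemma sv_exponent_mono:
  assumes "d > 0" "s \<le> t" shows "sv_exponent d s i \<le> sv_exponent d t i"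
proof (cases "s < real d \<and> \<not> t < real d")
  case True
  have "max 0 (min 1 (s - real i)) \<le> 1" by simp
  also have "1 \<le> t / real d" using True assms(1) by simp
  finally show ?thesis using True by (simp add: sv_exponent_def)
qed (use assms in \<open>auto simp: sv_exponent_def divide_right_mono\<close>)

lemma sv_exponent_nonneg: "0 \<le> s \<Longrightarrow> 0 \<le> sv_exponent d s i"
  by (simp add: sv_exponent_def)

lemma svf_below_dim:
  fixes A :: "real^'d^'d"
  assumes k: "k < CARD('d)" and th: "0 \<le> \<theta>" "\<theta> < 1"
  shows "svf (real k + \<theta>) A = (\<Prod>r<k. singular_value (Suc r) A) * rpow (singular_value (Suc k) A) \<theta>"
proof -
  have "nat \<lfloor>real k + \<theta>\<rfloor> = k" using th by linarith
  moreover have "real k + \<theta> < real CARD('d)" using k th by linarith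
  ultimately show ?thesis by (simp add: svf_def prod.atLeast1_atMost_eq)
qed

lemma rpow_prod: "rpow (\<Prod>i\<in>S. f i) t = (\<Prod>i\<in>S. rpow (f i) t)"
  by (induction S rule: infinite_finite_induct) (simp_all add: rpow_mult, simp_all add: rpow_def)

lemma svf_eq_prod_rpow:
  fixes A :: "real^'d^'d"
  assumes s: "0 \<le> s"
  shows "svf s A = (\<Prod>i<CARD('d). rpow (singular_value (Suc i) A) (sv_exponent CARD('d) s i))"
proof (cases "s < CARD('d)")
  case False
  then show ?thesis by (simp add: svf_def sv_exponent_def abs_det_eq_prod_singular_values rpow_prod)
next
  case True
  define k where "k = nat \<lfloor>s\<rfloor>"
  define th where "th = s - real k"
  have th: "0 \<le> th" "th < 1" and sk: "s = real k + th" using s by (auto simp: th_def k_def) linarith+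
  have k: "k < CARD('d)" using True th sk by simp
  have "(\<Prod>i<CARD('d). rpow (singular_value (Suc i) A) (sv_exponent CARD('d) s i)) =
        (\<Prod>i<Suc k. rpow (singular_value (Suc i) A) (sv_exponent CARD('d) s i))"
  proof (rule prod.mono_neutral_right)
    show "\<forall>i\<in>{..<CARD('d)} - {..<Suc k}. rpow (singular_value (Suc i) A) (sv_exponent CARD('d) s i) = 1"
    proof
      fix i assume "i \<in> {..<CARD('d)} - {..<Suc k}"
      then have "s - real i \<le> 0" using sk th by auto
      then show "rpow (singular_value (Suc i) A) (sv_exponent CARD('d) s i) = 1"
        using True by (simp add: sv_exponent_def)
    qed
  qed (use k in auto)
  also have "\<dots> = (\<Prod>r<k. singular_value (Suc r) A) * rpow (singular_value (Suc k) A) th"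
  proof -
    have "sv_exponent CARD('d) s k = th"
      using True th by (simp add: sv_exponent_def th_def[symmetric])
    moreover have "rpow (singular_value (Suc r) A) (sv_exponent CARD('d) s r) = singular_value (Suc r) A"
      if "r < k" for r
    proof -
      have "1 \<le> s - real r" using that sk th by simp
      then have "sv_exponent CARD('d) s r = 1" using True by (simp add: sv_exponent_def)
      then show ?thesis using that k by (simp add: singular_value_nonneg)
    qed
    ultimately show ?thesis by simp
  qed
  also have "\<dots> = svf s A" unfolding sk by (rule svf_below_dim[OF k th, symmetric])
  finally show ?thesis by simp
qed

lemma svf_nonneg: "0 \<le> s \<Longrightarrow> 0 \<le> svf s A"
  by (simp add: svf_eq_prod_rpow prod_nonneg)

text \<open>
  Raising \<open>s\<close> to \<open>t\<close> raises the exponents of the singular values by \<open>t - s\<close> in total, and every singular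
  value is at most \<open>x\<close>.
\<close>

lemma svf_le_svf_mult:
  fixes A :: "real^'d^'d"
  assumes st: "0 \<le> s" "s \<le> t" and x: "0 < x" "onorm ((*v) A) \<le> x"
  shows "svf t A \<le> svf s A * x powr (t - s)"
proof -
  let ?d = "CARD('d)"
  define w where "w = (\<lambda>i. sv_exponent ?d t i - sv_exponent ?d s i)"
  have w0: "0 \<le> w i" for i using sv_exponent_mono[of ?d s t i] st by (simp add: w_def)
  have "svf t A = (\<Prod>i<?d. rpow (singular_value (Suc i) A) (sv_exponent ?d s i + w i))"
    using st by (simp add: svf_eq_prod_rpow w_def)
  also have "\<dots> = svf s A * (\<Prod>i<?d. rpow (singular_value (Suc i) A) (w i))"
    using st w0 by (simp add: rpow_add sv_exponent_nonneg prod.distrib svf_eq_prod_rpow)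
  also have "\<dots> \<le> svf s A * (\<Prod>i<?d. x powr w i)"
  proof (intro mult_left_mono prod_mono conjI)
    fix i assume i: "i \<in> {..<?d}"
    have "rpow (singular_value (Suc i) A) (w i) \<le> rpow x (w i)"
      using i w0 x singular_value_le_onorm[of i A]
      by (intro rpow_mono) (auto simp: singular_value_nonneg)
    then show "rpow (singular_value (Suc i) A) (w i) \<le> x powr w i"
      using x by (simp add: rpow_def split: if_splits)
  qed (use st in \<open>auto simp: svf_nonneg\<close>)
  also have "(\<Prod>i<?d. x powr w i) = x powr (\<Sum>i<?d. w i)"
    using x by (simp add: powr_sum)
  also have "(\<Sum>i<?d. w i) = t - s"
    using st by (simp add: w_def sum_subtractf sum_sv_exponent)
  finally show ?thesis .
qed

lemma mat_norm1_mult_le: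
  assumes "\<And>x y. x \<in> X \<Longrightarrow> y \<in> X \<Longrightarrow> M x y = (\<Sum>z\<in>X. L x z * N z y)" and X: "finite X"
  shows "mat_norm1 X M \<le> mat_norm1 X L * mat_norm1 X N"
proof -
  have "mat_norm1 X M \<le> (\<Sum>x\<in>X. \<Sum>y\<in>X. \<Sum>z\<in>X. \<bar>L x z\<bar> * \<bar>N z y\<bar>)"
    unfolding mat_norm1_def
    by (intro sum_mono) (auto simp: assms(1) abs_mult intro!: order_trans[OF sum_abs])
  also have "\<dots> = (\<Sum>x\<in>X. \<Sum>z\<in>X. \<bar>L x z\<bar> * (\<Sum>y\<in>X. \<bar>N z y\<bar>))"
    unfolding sum_distrib_left by (intro sum.cong[OF refl] sum.swap)
  also have "\<dots> \<le> (\<Sum>x\<in>X. \<Sum>z\<in>X. \<bar>L x z\<bar> * mat_norm1 X N)"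
    unfolding mat_norm1_def using X
    by (intro sum_mono mult_left_mono member_le_sum) (auto intro!: sum_nonneg)
  also have "\<dots> = mat_norm1 X L * mat_norm1 X N"
    by (simp add: mat_norm1_def sum_distrib_right)
  finally show ?thesis .
qed

lemma young_norm_nonneg: "0 \<le> young_norm R A"
  by (simp add: young_norm_def mat_norm1_nonneg)

lemma submultiplicative_young_norm: 
  assumes "finite R" shows "submultiplicative (young_norm R :: real^'d^'d \<Rightarrow> real)"
  unfolding submultiplicative_def
proof (intro conjI allI young_norm_nonneg)
  fix A B :: "real^'d^'d"
  show "young_norm R (A ** B) \<le> young_norm R A * young_norm R B"
    unfolding young_norm_def
    by (intro mat_norm1_mult_le young_rep_mult finite_tensor_index assms)
  have "continuous_on UNIV (\<lambda>A :: real^'d^'d. A $ i $ j)" for i j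
    by (intro continuous_intros)
  then show "continuous_on UNIV (young_norm R :: real^'d^'d \<Rightarrow> real)"
    unfolding young_norm_def mat_norm1_def young_rep_def
    by (intro continuous_intros) (use card_young_perms_pos[OF assms] in auto)
qed

lemma submultiplicative_mult:
  assumes "submultiplicative f" "submultiplicative g"
  shows "submultiplicative (\<lambda>A. f A * g A)"
proof -
  have "f (A ** B) * g (A ** B) \<le> f A * g A * (f B * g B)" for A B
  proof -
    have "f (A ** B) * g (A ** B) \<le> (f A * f B) * (g A * g B)"
      using assms by (intro mult_mono) (auto simp: submultiplicative_def)
    then show ?thesis by (simp add: mult_ac)
  qed
  then show ?thesis using assms by (auto simp: submultiplicative_def intro!: continuous_intros)
qed

lemma submultiplicative_rpow:
  assumes "submultiplicative f" "0 \<le> t"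
  shows "submultiplicative (\<lambda>A. rpow (f A) t)"
proof (cases "t = 0")
  case True then show ?thesis by (simp add: submultiplicative_def)
next
  case False
  have "rpow (f (A ** B)) t \<le> rpow (f A) t * rpow (f B) t" for A B
    unfolding rpow_mult[symmetric] using assms
    by (intro rpow_mono) (auto simp: submultiplicative_def)
  moreover have "continuous_on UNIV (\<lambda>A. f A powr t)"
    using assms False by (intro continuous_on_powr') (auto simp: submultiplicative_def)
  ultimately show ?thesis using False by (simp add: submultiplicative_def rpow_def)
qed

lemma comparable_mult:
  assumes "comparable f f'" "comparable g g'"
    and "\<And>x. 0 \<le> f x" "\<And>x. 0 \<le> f' x" "\<And>x. 0 \<le> g x" "\<And>x. 0 \<le> g' x"
  shows "comparable (\<lambda>x. f x * g x) (\<lambda>x. f' x * g' x)"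
proof -
  obtain c where c: "c > 0" "\<And>x. f x \<le> c * f' x" "\<And>x. f' x \<le> c * f x"
    using assms(1) by (auto simp: comparable_def)
  obtain d where d: "d > 0" "\<And>x. g x \<le> d * g' x" "\<And>x. g' x \<le> d * g x"
    using assms(2) by (auto simp: comparable_def)
  have "f x * g x \<le> (c * d) * (f' x * g' x)" "f' x * g' x \<le> (c * d) * (f x * g x)" for x
  proof -
    have "f x * g x \<le> (c * f' x) * (d * g' x)"
      using assms(3-6) c d by (intro mult_mono) auto
    then show "f x * g x \<le> (c * d) * (f' x * g' x)" by (simp add: mult_ac)
    have "f' x * g' x \<le> (c * f x) * (d * g x)"
      using assms(3-6) c d by (intro mult_mono) auto
    then show "f' x * g' x \<le> (c * d) * (f x * g x)" by (simp add: mult_ac)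
  qed
  then show ?thesis unfolding comparable_def using c d by (intro exI[of _ "c * d"]) auto
qed

lemma comparable_rpow:
  assumes "comparable f g" "0 \<le> t" and "\<And>x. 0 \<le> f x" "\<And>x. 0 \<le> g x"
  shows "comparable (\<lambda>x. rpow (f x) t) (\<lambda>x. rpow (g x) t)"
proof -
  obtain c where c: "c > 0" "\<And>x. f x \<le> c * g x" "\<And>x. g x \<le> c * f x"
    using assms(1) by (auto simp: comparable_def)
  have "0 < rpow c t" using c by (simp add: rpow_def)
  then show ?thesis
    unfolding comparable_def rpow_mult[symmetric]
    using assms(2-4) c by (intro exI[of _ "rpow c t"]) (auto simp: rpow_mult[symmetric] intro!: rpow_mono)
qed

lemma comparable_young_norm:
  fixes k :: "nat \<Rightarrow> nat" and q :: nat
  assumes "\<And>j. k j \<le> CARD('d)"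
  shows "comparable (\<lambda>A :: real^'d^'d. \<Prod>j<q. \<Prod>r<k j. singular_value (Suc r) A)
           (young_norm (SIGMA j:{..<q}. {..<k j}))"
  using young_norm_comparable[of k q, OF assms] unfolding comparable_def .

lemma prod_singular_values_nonneg:
  "k \<le> CARD('d) \<Longrightarrow> 0 \<le> (\<Prod>r<k. singular_value (Suc r) (A :: real^'d^'d))"
  by (intro prod_nonneg ballI singular_value_nonneg) auto

lemma svf_ge_dim_comparable:
  fixes s :: real
  assumes s: "s \<ge> CARD('d)"
  shows "comparable (svf s :: real^'d^'d \<Rightarrow> real)
           (\<lambda>A. rpow (young_norm (SIGMA j:{..<1}. {..<CARD('d)}) A) (s / CARD('d)))"
proof -
  have "svf s A = rpow (\<Prod>j<(1::nat). \<Prod>r<CARD('d). singular_value (Suc r) A) (s / CARD('d))" for A :: "real^'d^'d"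
    using s by (simp add: svf_def abs_det_eq_prod_singular_values)
  then have eq: "svf s = (\<lambda>A :: real^'d^'d. rpow (\<Prod>j<(1::nat). \<Prod>r<CARD('d). singular_value (Suc r) A) (s / CARD('d)))"
    by (rule ext)
  show ?thesis
    unfolding eq using s by (intro comparable_rpow comparable_young_norm young_norm_nonneg)
      (auto intro: prod_nonneg prod_singular_values_nonneg order_trans[OF of_nat_0_le_iff])
qed

text \<open>
  Below the dimension \<open>\<phi>\<^sup>s\<close> interpolates geometrically between \<open>\<sigma>\<^sub>1 \<dots> \<sigma>\<^sub>k\<close> and \<open>\<sigma>\<^sub>1 \<dots> \<sigma>\<^sub>k \<sigma>\<^bsub>k+1\<^esub>\<close>,
  and each of these is comparable to the norm of an exterior power.  This holds for every real \<open>s\<close>, and it is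
  what makes the limit in the pressure exist.
\<close>

lemma svf_comparable_submultiplicative:
  assumes s: "0 < s"
  obtains f :: "real^'d^'d \<Rightarrow> real" where "submultiplicative f" "comparable (svf s) f"
proof (cases "s < CARD('d)")
  case False
  then have "0 \<le> s / CARD('d)" "s \<ge> CARD('d)" using s by auto
  then show ?thesis
    using that[OF submultiplicative_rpow[OF submultiplicative_young_norm] svf_ge_dim_comparable] by simp
next
  case True
  define k where "k = nat \<lfloor>s\<rfloor>"
  define th where "th = s - real k"
  have th: "0 \<le> th" "th < 1" and sk: "s = real k + th" using s by (auto simp: th_def k_def) linarith+
  have k: "k < CARD('d)" using True th sk by simp
  define P where "P = (\<lambda>k (A :: real^'d^'d). \<Prod>j<(1::nat). \<Prod>r<k. singular_value (Suc r) A)"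
  define N where "N = (\<lambda>k :: nat. young_norm (SIGMA j:{..<1}. {..<k}) :: real^'d^'d \<Rightarrow> real)"
  have P0: "0 \<le> P k A" if "k \<le> CARD('d)" for k A
    using that by (simp add: P_def prod_singular_values_nonneg)
  have cmp: "comparable (P k) (N k)" if "k \<le> CARD('d)" for k
    unfolding P_def N_def using that by (rule comparable_young_norm)
  have "svf s A = rpow (P k A) (1 - th) * rpow (P (Suc k) A) th" for A
  proof -
    have "rpow (P k A) (1 - th) * rpow (P (Suc k) A) th =
        rpow (P k A) ((1 - th) + th) * rpow (singular_value (Suc k) A) th"
      using th by (subst rpow_add) (auto simp: P_def rpow_mult)
    also have "\<dots> = svf s A"
      using th P0[of k A] k by (simp add: sk svf_below_dim) (simp add: P_def)
    finally show ?thesis by simp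
  qed
  then have eq: "svf s = (\<lambda>A. rpow (P k A) (1 - th) * rpow (P (Suc k) A) th)" by (rule ext)
  have "comparable (svf s) (\<lambda>A. rpow (N k A) (1 - th) * rpow (N (Suc k) A) th)"
    unfolding eq using th k by (intro comparable_mult comparable_rpow cmp P0) (auto simp: N_def young_norm_nonneg)
  moreover have "submultiplicative (\<lambda>A. rpow (N k A) (1 - th) * rpow (N (Suc k) A) th)"
    unfolding N_def using th
    by (intro submultiplicative_mult submultiplicative_rpow submultiplicative_young_norm) auto
  ultimately show ?thesis using that by blast
qed

text \<open>
  For rational \<open>s\<close> the interpolation is realised by a single representation, whose norm is
  multiplicative on the tensor factors; a geometric mean of norms of two
  different representations could not be fed into \<open>spread_inequality\<close>.
\<close>

lemma svf_rational_comparable_young_norm: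
  assumes s: "0 < s" "s \<in> \<rat>"
  obtains R t where "finite R" "t > 0"
    "comparable (svf s :: real^'d^'d \<Rightarrow> real) (\<lambda>A. young_norm R A powr t)"
proof (cases "s < CARD('d)")
  case False
  then have "s / CARD('d) > 0" "s \<ge> CARD('d)" using s by auto
  moreover from this have "comparable (svf s :: real^'d^'d \<Rightarrow> real)
           (\<lambda>A. young_norm (SIGMA j:{..<1}. {..<CARD('d)}) A powr (s / CARD('d)))"
    using svf_ge_dim_comparable[where s = s and 'd = 'd] s by (simp add: rpow_def)
  ultimately show ?thesis
    by (intro that[of "SIGMA j:{..<1}. {..<CARD('d)}" "s / CARD('d)"]) auto
next
  case True
  define k where "k = nat \<lfloor>s\<rfloor>"
  define th where "th = s - real k"
  have th: "0 \<le> th" "th < 1" and sk: "s = real k + th" using s by (auto simp: th_def k_def) linarith+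
  have k: "k < CARD('d)" using True th sk by simp
  have "th \<in> \<rat>" using s by (simp add: th_def)
  then obtain b q :: nat where q: "q \<noteq> 0" "\<bar>th\<bar> = b / q" by (rule Rats_abs_nat_div_natE)
  have thq: "th = b / q" using q th by simp
  have bq: "b < q" using th q by (simp add: thq)
  \<comment> \<open>With these block sizes the product of the singular values over all blocks is \<open>(svf s A) ^ q\<close>.\<close>
  define kk where "kk = (\<lambda>j. if j < b then Suc k else k)"
  have kk: "kk j \<le> CARD('d)" for j using k by (simp add: kk_def)
  have "svf s A = rpow (\<Prod>j<q. \<Prod>r<kk j. singular_value (Suc r) A) (1 / q)" for A :: "real^'d^'d"
  proof -
    define P where "P = (\<Prod>r<k. singular_value (Suc r) A)"
    define z where "z = singular_value (Suc k) A"
    have P0: "0 \<le> P" and z0: "0 \<le> z" using k by (auto simp: P_def z_def prod_singular_values_nonneg singular_value_nonneg)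
    have "(\<Prod>j<q. \<Prod>r<kk j. singular_value (Suc r) A) = (\<Prod>j<q. P * (if j < b then z else 1))"
      by (intro prod.cong[OF refl]) (simp add: kk_def P_def z_def)
    also have "\<dots> = P ^ q * (\<Prod>j<q. if j < b then z else 1)" by (simp add: prod.distrib)
    also have "(\<Prod>j<q. if j < b then z else 1) = (\<Prod>j<b. z)"
      using bq by (intro prod.mono_neutral_cong_right) auto
    finally have "rpow (\<Prod>j<q. \<Prod>r<kk j. singular_value (Suc r) A) (1 / q) =
        rpow (P ^ q) (1 / q) * rpow (z ^ b) (1 / q)"
      by (simp add: rpow_mult)
    also have "rpow (P ^ q) (1 / q) = P"
      using P0 q rpow_power_root[of P q q] by simp
    also have "rpow (z ^ b) (1 / q) = rpow z th"
      using z0 q rpow_power_root[of z q b] by (simp add: thq)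
    finally show ?thesis unfolding sk svf_below_dim[OF k th] by (simp add: P_def z_def)
  qed
  then have eq: "svf s = (\<lambda>A :: real^'d^'d. rpow (\<Prod>j<q. \<Prod>r<kk j. singular_value (Suc r) A) (1 / q))" by (rule ext)
  have "comparable (svf s :: real^'d^'d \<Rightarrow> real) (\<lambda>A. rpow (young_norm (SIGMA j:{..<q}. {..<kk j}) A) (1 / q))"
    unfolding eq by (intro comparable_rpow comparable_young_norm young_norm_nonneg kk prod_nonneg
        prod_singular_values_nonneg ballI) auto
  then have "comparable (svf s :: real^'d^'d \<Rightarrow> real) (\<lambda>A. young_norm (SIGMA j:{..<q}. {..<kk j}) A powr (1 / q))"
    using q by (simp add: rpow_def)
  then show ?thesis using q by (intro that[of "SIGMA j:{..<q}. {..<kk j}" "1 / q"]) auto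
qed

section \<open>Semicontinuity of the affinity dimension\<close>

text \<open>
  A characterisation in terms of \<open>\<phi>\<^sup>s\<close> alone, which allows different values of \<open>s\<close> to be compared.
\<close>

lemma pressure_neg_iff_tendsto:
  fixes A :: "real^'d^'d^'N"
  assumes s: "0 < s"
  shows "pressure A s < 0 \<longleftrightarrow> word_sum (svf s) A \<longlonglongrightarrow> 0"
proof -
  obtain f :: "real^'d^'d \<Rightarrow> real" where f: "submultiplicative f" and cmp: "comparable (svf s) f"
    using svf_comparable_submultiplicative[OF s] by blast
  obtain c where c: "c > 0" "\<And>n. word_sum (svf s) A n \<le> c * word_sum f A n"
    "\<And>n. word_sum f A n \<le> c * word_sum (svf s) A n"
    using comparable_word_sum[OF cmp, of A] unfolding comparable_def by blast
  have s0: "0 \<le> word_sum (svf s) A n" for n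
    using s by (intro word_sum_nonneg svf_nonneg) simp
  show ?thesis
  proof
    assume "pressure A s < 0"
    then obtain m where "m \<ge> 1" "word_sum f A m < 1" using pressure_neg_iff[OF f cmp] by blast
    from word_sum_exponential_decay[OF f this]
    obtain C x where Cx: "0 < x" "x < 1" "\<And>n. word_sum f A n \<le> C * x ^ n" by blast
    have "(\<lambda>n. c * (C * x ^ n)) \<longlonglongrightarrow> c * (C * 0)"
      using Cx by (intro tendsto_intros LIMSEQ_power_zero) auto
    then have "(\<lambda>n. c * (C * x ^ n)) \<longlonglongrightarrow> 0" by simp
    moreover have "norm (word_sum (svf s) A n) \<le> c * (C * x ^ n)" for n
      using order_trans[OF c(2)[of n] mult_left_mono[OF Cx(3)[of n], of c]] c(1) s0[of n] by simp
    ultimately show "word_sum (svf s) A \<longlonglongrightarrow> 0"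
      by - (rule Lim_null_comparison[of _ "\<lambda>n. c * (C * x ^ n)"], auto)
  next
    assume "word_sum (svf s) A \<longlonglongrightarrow> 0"
    then have "(\<lambda>n. c * word_sum (svf s) A n) \<longlonglongrightarrow> c * 0" by (intro tendsto_intros)
    then have "\<forall>\<^sub>F n in sequentially. c * word_sum (svf s) A n < 1" by (rule order_tendstoD(2)) simp
    then have "\<forall>\<^sub>F n in sequentially. n \<ge> 1 \<and> c * word_sum (svf s) A n < 1"
      using eventually_ge_at_top[of 1] by eventually_elim auto
    then obtain n where "n \<ge> 1" "c * word_sum (svf s) A n < 1"
      using eventually_happens'[OF sequentially_bot] by blast
    then have "\<exists>n\<ge>1. word_sum f A n < 1" using c(3)[of n] by (intro exI[of _ n]) auto
    then show "pressure A s < 0" using pressure_neg_iff[OF f cmp] by blast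
  qed
qed

definition contraction_tuples :: "(real^'d^'d^'N) set" where
  "contraction_tuples = {A. \<forall>i. A $ i \<in> op_unit_ball}"

lemma onorm_word_prod_le:
  fixes A :: "real^'d^'d^'N"
  assumes r: "0 < r" "\<And>i. onorm ((*v) (A $ i)) \<le> r"
  shows "onorm ((*v) (word_prod A w)) \<le> r ^ length w"
proof (induction w)
  case Nil
  have "(*v) (word_prod A []) = (\<lambda>x. x)" by (rule ext) (simp add: word_prod_def)
  then show ?case by (simp add: onorm_id_le)
next
  case (Cons i w)
  have "(*v) (word_prod A (i # w)) = (*v) (A $ i) \<circ> (*v) (word_prod A w)"
    by (rule ext) (simp add: word_prod_def matrix_vector_mul_assoc)
  then have "onorm ((*v) (word_prod A (i # w))) \<le> onorm ((*v) (A $ i)) * onorm ((*v) (word_prod A w))"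
    by (simp add: onorm_compose)
  also have "\<dots> \<le> r * r ^ length w"
    using r Cons by (intro mult_mono onorm_pos_le) auto
  finally show ?case by simp
qed

lemma word_sum_svf_contraction:
  fixes A :: "real^'d^'d^'N"
  assumes A: "A \<in> contraction_tuples"
  obtains r where "0 < r" "r < 1"
    "\<And>s t n. 0 \<le> s \<Longrightarrow> s \<le> t \<Longrightarrow>
       word_sum (svf t) A n \<le> word_sum (svf s) A n * (r powr (t - s)) ^ n"
proof -
  \<comment> \<open>The value \<open>1 / 2\<close> keeps \<open>r\<close> positive when all matrices vanish.\<close>
  define r where "r = Max (insert (1 / 2) (range (\<lambda>i. onorm ((*v) (A $ i)))))"
  have r0: "0 < r" using Max_ge[of "insert (1 / 2) (range (\<lambda>i. onorm ((*v) (A $ i))))" "1 / 2"]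
    by (simp add: r_def)
  have r1: "r < 1" using A by (simp add: r_def contraction_tuples_def op_unit_ball_def)
  have le: "onorm ((*v) (A $ i)) \<le> r" for i unfolding r_def by (intro Max_ge) auto
  have "word_sum (svf t) A n \<le> word_sum (svf s) A n * (r powr (t - s)) ^ n"
    if st: "0 \<le> s" "s \<le> t" for s t n
    unfolding word_sum_def sum_distrib_right
  proof (intro sum_mono)
    fix w :: "'N list" assume "w \<in> {w. length w = n}"
    then have "onorm ((*v) (word_prod A w)) \<le> r ^ n" using onorm_word_prod_le[OF r0 le, of w] by simp
    then have "svf t (word_prod A w) \<le> svf s (word_prod A w) * (r ^ n) powr (t - s)"
      using r0 st by (intro svf_le_svf_mult) auto
    also have "(r ^ n) powr (t - s) = (r powr (t - s)) ^ n"
      using r0 by (simp add: powr_realpow[symmetric] powr_powr mult.commute)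
    finally show "svf t (word_prod A w) \<le> svf s (word_prod A w) * (r powr (t - s)) ^ n" .
  qed
  then show ?thesis using that r0 r1 by blast
qed

lemma pressure_neg_mono:
  assumes A: "A \<in> contraction_tuples" and s: "0 < s" "s \<le> t" and neg: "pressure A s < 0"
  shows "pressure A t < 0"
proof -
  obtain r where r: "0 < r" "r < 1" and le: "\<And>s t n. 0 \<le> s \<Longrightarrow> s \<le> t \<Longrightarrow>
       word_sum (svf t) A n \<le> word_sum (svf s) A n * (r powr (t - s)) ^ n"
    using word_sum_svf_contraction[OF A] by blast
  have "norm (word_sum (svf t) A n) \<le> word_sum (svf s) A n" for n
  proof -
    have "0 \<le> word_sum (svf s) A n" "0 \<le> word_sum (svf t) A n"
      using s by (auto intro!: word_sum_nonneg svf_nonneg)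
    moreover have "(r powr (t - s)) ^ n \<le> 1"
      using r s powr_mono2[of "t - s" r 1] by (intro power_le_one) auto
    ultimately show ?thesis
      using le[of s t n] s mult_left_mono[of "(r powr (t - s)) ^ n" 1 "word_sum (svf s) A n"] by simp
  qed
  moreover have "word_sum (svf s) A \<longlonglongrightarrow> 0" using neg pressure_neg_iff_tendsto[OF s(1)] by blast
  ultimately have "word_sum (svf t) A \<longlonglongrightarrow> 0"
    by - (rule Lim_null_comparison[of "word_sum (svf t) A" "word_sum (svf s) A"], auto)
  moreover have "0 < t" using s by simp
  ultimately show ?thesis using pressure_neg_iff_tendsto by blast
qed

lemma pressure_neg_exists:
  fixes A :: "real^'d^'d^'N"
  assumes A: "A \<in> contraction_tuples"
  shows "\<exists>s>0. pressure A s < 0"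
proof -
  obtain r where r: "0 < r" "r < 1" and le: "\<And>s t n. 0 \<le> s \<Longrightarrow> s \<le> t \<Longrightarrow>
       word_sum (svf t) A n \<le> word_sum (svf s) A n * (r powr (t - s)) ^ n"
    using word_sum_svf_contraction[OF A] by blast
  obtain f :: "real^'d^'d \<Rightarrow> real" where f: "submultiplicative f" and cmp: "comparable (svf 1) f"
    using svf_comparable_submultiplicative[OF zero_less_one] by blast
  obtain c where c: "c > 0" "\<And>n. word_sum (svf 1) A n \<le> c * word_sum f A n"
    using comparable_word_sum[OF cmp, of A] unfolding comparable_def by blast
  have f0: "0 \<le> word_sum f A n" for n
    using f by (intro word_sum_nonneg) (simp add: submultiplicative_def)
  define M where "M = word_sum f A 1"
  have "(\<lambda>j. r ^ j * M) \<longlonglongrightarrow> 0 * M"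
    using r by (intro tendsto_intros LIMSEQ_power_zero) auto
  then have "\<forall>\<^sub>F j in sequentially. r ^ j * M < 1" by (intro order_tendstoD(2)) auto
  then obtain j where j: "r ^ j * M < 1" using eventually_happens'[OF sequentially_bot] by blast
  define t where "t = 1 + real j"
  define C where "C = c * word_sum f A 0"
  have bound: "norm (word_sum (svf t) A n) \<le> C * (r ^ j * M) ^ n" for n
  proof -
    have "word_sum (svf t) A n \<le> word_sum (svf 1) A n * (r ^ j) ^ n"
      using le[of 1 t n] r by (simp add: t_def powr_realpow)
    also have "\<dots> \<le> (c * (M ^ n * word_sum f A 0)) * (r ^ j) ^ n"
    proof (intro mult_right_mono)
      have "word_sum f A n \<le> M ^ n * word_sum f A 0"
        using word_sum_mult_le[OF f, of A 1 n 0] by (simp add: M_def)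
      then show "word_sum (svf 1) A n \<le> c * (M ^ n * word_sum f A 0)"
        using c(1) by (intro order_trans[OF c(2)] mult_left_mono) auto
    qed (use r in simp)
    also have "\<dots> = C * (r ^ j * M) ^ n" by (simp add: C_def power_mult_distrib mult_ac)
    finally show ?thesis
      using word_sum_nonneg[of "svf t" A n] by (simp add: svf_nonneg t_def)
  qed
  have "(\<lambda>n. C * (r ^ j * M) ^ n) \<longlonglongrightarrow> C * 0"
    using j r f0[of 1] by (intro tendsto_intros LIMSEQ_power_zero) (simp add: M_def)
  then have "word_sum (svf t) A \<longlonglongrightarrow> 0"
    using bound by - (rule Lim_null_comparison[of _ "\<lambda>n. C * (r ^ j * M) ^ n"], auto)
  moreover have "0 < t" by (simp add: t_def)
  ultimately show ?thesis using pressure_neg_iff_tendsto by blast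
qed

lemma continuous_on_word_sum:
  assumes f: "submultiplicative f"
  shows "continuous_on S (\<lambda>A :: real^'d^'d^'N. word_sum f A n)"
proof -
  have "continuous_on UNIV (\<lambda>A :: real^'d^'d^'N. word_prod A w)" for w
  proof (induction w)
    case (Cons i w)
    have eq: "(\<lambda>A :: real^'d^'d^'N. word_prod A (i # w)) =
        (\<lambda>A. \<chi> a b. \<Sum>k\<in>UNIV. A $ i $ a $ k * word_prod A w $ k $ b)"
      by (rule ext) (simp add: word_prod_def matrix_matrix_mult_def)
    show ?case
      unfolding eq by (intro continuous_intros continuous_on_vec_lambda Cons)
  qed (simp add: word_prod_def)
  then have "continuous_on S (\<lambda>A :: real^'d^'d^'N. f (word_prod A w))" for w
    using f continuous_on_compose2[of UNIV f UNIV "\<lambda>A :: real^'d^'d^'N. word_prod A w"]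
      continuous_on_subset[of UNIV _ S] by (simp add: submultiplicative_def)
  then show ?thesis unfolding word_sum_def by (intro continuous_intros)
qed

text \<open>
  The antisymmetric projection is the value of the representation at the identity matrix; at the empty word it is replaced
  by the true identity, as \<open>spread_inequality\<close> requires.  Words of length at least 1 are not
  affected.
\<close>

lemma negative_pressure_spread:
  assumes s: "0 < s" "s \<in> \<rat>"
  obtains f :: "real^'d^'d \<Rightarrow> real" and D K where
    "submultiplicative f" "comparable (svf s) f" "D \<ge> 1" "K > 0"
    "\<And>(A :: real^'d^'d^'N) n. pressure A s < 0 \<Longrightarrow> n \<ge> 1 \<Longrightarrow>
       word_sum f A (D * n) \<le> K * word_sum f A n ^ (D - 1)"
proof -
  obtain R t where R: "finite R" and t: "t > 0"
    and cmp: "comparable (svf s :: real^'d^'d \<Rightarrow> real) (\<lambda>A. young_norm R A powr t)"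
    using svf_rational_comparable_young_norm[OF s] by blast
  define f where "f = (\<lambda>A :: real^'d^'d. young_norm R A powr t)"
  define X where "X = (tensor_index R :: (nat \<times> nat \<Rightarrow> 'd) set)"
  have X: "finite X" "X \<noteq> {}" using finite_tensor_index[OF R] tensor_index_nonempty by (auto simp: X_def)
  have f: "submultiplicative f"
    using submultiplicative_rpow[OF submultiplicative_young_norm[OF R], of t] t by (simp add: f_def rpow_def)
  have cmpf: "comparable (svf s) f" using cmp by (simp add: f_def)
  obtain K where K: "K > 0" and spread: "\<And>(B :: 'N list \<Rightarrow> _ \<Rightarrow> _ \<Rightarrow> real) n.
      (\<forall>x\<in>X. \<forall>y\<in>X. B [] x y = (if x = y then 1 else 0)) \<Longrightarrow>
      (\<forall>u v. \<forall>x\<in>X. \<forall>y\<in>X. B (u @ v) x y = (\<Sum>z\<in>X. B u x z * B v z y)) \<Longrightarrow>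
      summable (\<lambda>m. \<Sum>w | length w = m * n. mat_norm1 X (B w) powr t) \<Longrightarrow>
      (\<Sum>w | length w = card X * n. mat_norm1 X (B w) powr t) \<le>
        K * (\<Sum>w | length w = n. mat_norm1 X (B w) powr t) ^ (card X - 1)"
    using spread_inequality[OF X t, where 'n = 'N] by blast
  have D: "card X \<ge> 1" using X by (simp add: Suc_le_eq card_gt_0_iff)
  have main: "word_sum f A (card X * n) \<le> K * word_sum f A n ^ (card X - 1)"
    if neg: "pressure A s < 0" and n: "n \<ge> 1" for A :: "real^'d^'d^'N" and n
  proof -
    define B where "B = (\<lambda>w. if w = [] then (\<lambda>x y. if x = y then 1 else 0) else young_rep R (word_prod A w))"
    have S: "(\<Sum>w | length w = m. mat_norm1 X (B w) powr t) = word_sum f A m" if "m \<ge> 1" for m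
      unfolding word_sum_def f_def young_norm_def X_def[symmetric]
      using that by (intro sum.cong[OF refl]) (auto simp: B_def)
    obtain m where "m \<ge> 1" "word_sum f A m < 1" using neg pressure_neg_iff[OF f cmpf] by blast
    from word_sum_exponential_decay[OF f this]
    obtain C x where Cx: "0 < x" "x < 1" "\<And>n. word_sum f A n \<le> C * x ^ n" by blast
    have "(\<Sum>w | length w = card X * n. mat_norm1 X (B w) powr t) \<le>
        K * (\<Sum>w | length w = n. mat_norm1 X (B w) powr t) ^ (card X - 1)"
    proof (rule spread)
      show "\<forall>x\<in>X. \<forall>y\<in>X. B [] x y = (if x = y then 1 else 0)" by (simp add: B_def)
      show "\<forall>u v. \<forall>x\<in>X. \<forall>y\<in>X. B (u @ v) x y = (\<Sum>z\<in>X. B u x z * B v z y)"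
      proof (intro allI ballI)
        fix u v x y assume xy: "x \<in> X" "y \<in> X"
        show "B (u @ v) x y = (\<Sum>z\<in>X. B u x z * B v z y)"
        proof (cases "u = [] \<or> v = []")
          case True
          have "(\<Sum>z\<in>X. B [] x z * M z y) = M x y" "(\<Sum>z\<in>X. M x z * B [] z y) = M x y" for M
            using xy X by (simp_all add: B_def mult_delta_left mult_delta_right)
          then show ?thesis using True by auto
        next
          case False
          then show ?thesis
            by (simp add: B_def word_prod_append young_rep_mult[OF R] X_def)
        qed
      qed
      have "norm (\<Sum>w | length w = m * n. mat_norm1 X (B w) powr t) \<le> C * (x ^ n) ^ m" if "m \<ge> 1" for m
      proof -
        have "m * n \<ge> 1" using that n by simp
        then have "(\<Sum>w | length w = m * n. mat_norm1 X (B w) powr t) \<le> C * x ^ (m * n)"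
          using Cx(3)[of "m * n"] S by simp
        then show ?thesis by (simp add: power_mult[symmetric] mult.commute sum_nonneg)
      qed
      note bound = this
      have "summable (\<lambda>m. C * (x ^ n) ^ m)"
        using Cx n by (intro summable_mult summable_geometric) (simp add: power_less_one_iff)
      then show "summable (\<lambda>m. \<Sum>w | length w = m * n. mat_norm1 X (B w) powr t)"
        by (rule summable_comparison_test'[where N = 1]) (rule bound)
    qed
    moreover have "card X * n \<ge> 1" using D n by simp
    ultimately show ?thesis using S n by simp
  qed
  show ?thesis by (rule that[OF f cmpf D K main])
qed

text \<open>
  If the pressure at \<open>s\<close> is not negative, then it is a finite number \<open>l \<ge> 0\<close> with \<open>D * l \<le> (D - 1) * l\<close>, hence
  zero.  Subexponential growth at \<open>s\<close> is then outweighed by the factor \<open>r powr (t - s)\<close> per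
  letter.
\<close>

lemma spread_imp_pressure_neg:
  fixes A :: "real^'d^'d^'N" and f :: "real^'d^'d \<Rightarrow> real"
  assumes A: "A \<in> contraction_tuples" and s: "0 < s" "s < t"
    and f: "submultiplicative f" and cmp: "comparable (svf s) f"
    and D: "D \<ge> 1" and K: "K > 0"
    and spread: "\<And>n. n \<ge> 1 \<Longrightarrow> word_sum f A (D * n) \<le> K * word_sum f A n ^ (D - 1)"
  shows "pressure A t < 0"
proof (cases "pressure A s < 0")
  case True
  then show ?thesis using pressure_neg_mono[OF A] s by auto
next
  case False
  define a where "a = word_sum f A"
  have a1: "1 \<le> a n" if "n \<ge> 1" for n
    using False that pressure_neg_iff[OF f cmp, of A] by (auto simp: a_def not_less)
  have sub: "a (m + n) \<le> a m * a n" for m n unfolding a_def by (rule word_sum_add_le[OF f])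
  have "0 \<le> a 0"
    using f unfolding a_def by (intro word_sum_nonneg) (simp add: submultiplicative_def)
  then have "0 < a 0" using sub[of 0 1] a1[of 1] by (cases "a 0 = 0") auto
  then have pos: "0 < a n" for n using a1[of n] by (cases n) auto
  define u where "u = (\<lambda>n. ln (a n))"
  have usub: "u (m + n) \<le> u m + u n" for m n
    unfolding u_def ln_mult_pos[OF pos pos, symmetric] using sub[of m n] pos by (simp add: ln_le_cancel_iff)
  have u0: "0 \<le> u n" if "n \<ge> 1" for n using a1[OF that] by (simp add: u_def)
  obtain l where l: "(\<lambda>n. u n / n) \<longlonglongrightarrow> l"
  proof -
    let ?L = "INF n\<in>{1..}. ereal (u n / n)"
    have "0 \<le> ?L" using u0 by (intro INF_greatest) auto
    moreover have "?L \<le> ereal (u 1 / real 1)" by (intro INF_lower) auto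
    ultimately obtain l where "?L = ereal l" by (cases ?L) auto
    then show ?thesis using that fekete_ereal[of u, OF usub] by simp
  qed
  have "l \<ge> 0" using u0 by (intro LIMSEQ_le_const[OF l]) (auto intro!: exI[of _ 1])
  have "l \<le> 0"
  proof -
    have "strict_mono (\<lambda>n. D * n)" using D by (auto simp: strict_mono_def)
    from LIMSEQ_subseq_LIMSEQ[OF l this]
    have "(\<lambda>n. u (D * n) / (D * n)) \<longlonglongrightarrow> l" by (simp add: comp_def)
    then have "(\<lambda>n. D * (u (D * n) / (D * n))) \<longlonglongrightarrow> D * l" by (intro tendsto_intros)
    moreover have "(\<lambda>n. ln K / n + (real D - 1) * (u n / n)) \<longlonglongrightarrow> 0 + (real D - 1) * l"
      by (intro tendsto_intros l lim_const_over_n)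
    moreover have "D * (u (D * n) / (D * n)) \<le> ln K / n + (real D - 1) * (u n / n)" if n: "n \<ge> 1" for n
    proof -
      have "u (D * n) \<le> ln (K * a n ^ (D - 1))"
        unfolding u_def using spread[OF n] pos K by (simp add: a_def)
      also have "\<dots> = ln K + (real D - 1) * u n"
        using pos[of n] K D by (simp add: ln_mult_pos ln_realpow u_def of_nat_diff)
      finally have "u (D * n) / n \<le> (ln K + (real D - 1) * u n) / n" by (simp add: divide_right_mono)
      then show ?thesis using D by (simp add: add_divide_distrib)
    qed
    ultimately have "D * l \<le> 0 + (real D - 1) * l" by (intro LIMSEQ_le) auto
    then show ?thesis by (simp add: algebra_simps)
  qed
  then have l0: "(\<lambda>n. u n / n) \<longlonglongrightarrow> 0" using l \<open>l \<ge> 0\<close> by simp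
  obtain r where r: "0 < r" "r < 1" and le: "\<And>s t n. 0 \<le> s \<Longrightarrow> s \<le> t \<Longrightarrow>
       word_sum (svf t) A n \<le> word_sum (svf s) A n * (r powr (t - s)) ^ n"
    using word_sum_svf_contraction[OF A] by blast
  obtain c where c: "c > 0" "\<And>n. word_sum (svf s) A n \<le> c * a n"
    using comparable_word_sum[OF cmp, of A] unfolding comparable_def a_def by blast
  define y where "y = r powr (t - s)"
  have y: "0 < y" "y < 1" using r s powr_less_mono2[of "t - s" r 1] by (auto simp: y_def)
  \<comment> \<open>Half of the gain \<open>- ln y\<close> per letter is enough to absorb the subexponential growth.\<close>
  define e where "e = - ln y / 2"
  have e: "0 < e" using y by (simp add: e_def)
  have ey: "exp e * y = exp (- e)"
  proof -
    have "y = exp (- 2 * e)" using y by (simp add: e_def)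
    then show ?thesis by (simp add: exp_add[symmetric])
  qed
  have "\<forall>\<^sub>F n in sequentially. u n / n < e" using l0 e by (rule order_tendstoD(2))
  then have "\<forall>\<^sub>F n in sequentially. norm (word_sum (svf t) A n) \<le> c * exp (- e) ^ n"
    using eventually_ge_at_top[of 1]
  proof eventually_elim
    case (elim n)
    have "u n \<le> n * e" using elim by (simp add: field_simps)
    moreover have "a n = exp (u n)" using pos[of n] by (simp add: u_def)
    ultimately have "a n \<le> exp (n * e)" by simp
    then have an: "a n \<le> exp e ^ n" by (simp add: exp_of_nat_mult)
    have "word_sum (svf t) A n \<le> word_sum (svf s) A n * y ^ n"
      using le[of s t n] s by (simp add: y_def)
    also have "\<dots> \<le> (c * exp e ^ n) * y ^ n"
      using order_trans[OF c(2)[of n] mult_left_mono[OF an, of c]] c y by (intro mult_right_mono) auto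
    also have "\<dots> = c * exp (- e) ^ n" by (simp add: ey[symmetric] power_mult_distrib)
    finally show ?case
      using word_sum_nonneg[of "svf t" A n] s by (simp add: svf_nonneg)
  qed
  moreover have "(\<lambda>n. c * exp (- e) ^ n) \<longlonglongrightarrow> c * 0"
    using e by (intro tendsto_intros LIMSEQ_power_zero) auto
  ultimately have "word_sum (svf t) A \<longlonglongrightarrow> 0"
    by - (rule Lim_null_comparison, auto)
  moreover have "0 < t" using s by simp
  ultimately show ?thesis using pressure_neg_iff_tendsto by blast
qed

lemma affinity_dim_le: "0 < s \<Longrightarrow> pressure A s < 0 \<Longrightarrow> affinity_dim A \<le> ereal s"
  unfolding affinity_dim_def by (intro Inf_lower) auto

lemma affinity_dim_ge:
  assumes "A \<in> contraction_tuples" "0 < s" "\<not> pressure A s < 0"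
  shows "ereal s \<le> affinity_dim A"
  unfolding affinity_dim_def
proof (rule Inf_greatest)
  fix x assume "x \<in> ereal ` {s. s > 0 \<and> pressure A s < 0}"
  then obtain t where t: "x = ereal t" "t > 0" "pressure A t < 0" by auto
  then have "\<not> t < s" using pressure_neg_mono[OF assms(1), of t s] assms(3) by auto
  then show "ereal s \<le> x" using t by simp
qed

lemma affinity_dim_nonneg: "0 \<le> affinity_dim A"
  unfolding affinity_dim_def by (intro Inf_greatest) auto

lemma affinity_dim_upper_semicontinuous:
  fixes A :: "real^'d^'d^'N"
  assumes "A \<in> contraction_tuples" and a: "affinity_dim A < a"
  shows "\<forall>\<^sub>F A' in at A within contraction_tuples. affinity_dim A' < a"
proof -
  obtain s where s: "s > 0" "pressure A s < 0" "ereal s < a"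
    using a unfolding affinity_dim_def by (auto simp: Inf_less_iff)
  obtain f :: "real^'d^'d \<Rightarrow> real" where f: "submultiplicative f" and cmp: "comparable (svf s) f"
    using svf_comparable_submultiplicative[OF s(1)] by blast
  obtain n where n: "n \<ge> 1" "word_sum f A n < 1" using s(2) pressure_neg_iff[OF f cmp] by blast
  have "((\<lambda>A. word_sum f A n) \<longlongrightarrow> word_sum f A n) (at A within contraction_tuples)"
    using continuous_on_word_sum[OF f, of contraction_tuples n] assms(1) unfolding continuous_on_def by blast
  then have "\<forall>\<^sub>F A' in at A within contraction_tuples. word_sum f A' n < 1"
    using n(2) by (rule order_tendstoD(2))
  then show ?thesis
  proof eventually_elim
    case (elim A')
    then have "pressure A' s < 0" using n(1) pressure_neg_iff[OF f cmp] by blast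
    then show ?case using affinity_dim_le[OF s(1)] s(3) by (metis le_less_trans)
  qed
qed

text \<open>
  For rational \<open>s\<close> and real \<open>t\<close> with \<open>a < s < t < affinity_dim A\<close>, the tuple \<open>A\<close> violates the spread inequality
  for some \<open>n\<close>.  The violation persists nearby by continuity and excludes negative pressure at \<open>s\<close>.
\<close>

lemma affinity_dim_lower_semicontinuous:
  fixes A :: "real^'d^'d^'N"
  assumes A: "A \<in> contraction_tuples" and a: "a < affinity_dim A"
  shows "\<forall>\<^sub>F A' in at A within contraction_tuples. a < affinity_dim A'"
proof (cases "a < 0")
  case True
  then show ?thesis by (intro always_eventually allI) (metis affinity_dim_nonneg less_le_trans)
next
  case False
  obtain q :: rat where q: "a < ereal (real_of_rat q)" "ereal (real_of_rat q) < affinity_dim A"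
    using ereal_dense3[OF a] by auto
  define s where "s = real_of_rat q"
  have "0 \<le> a" using False by simp
  then have "0 < ereal s" using q(1) unfolding s_def by (rule le_less_trans)
  then have s: "0 < s" "s \<in> \<rat>" by (simp_all add: s_def)
  obtain t where t: "s < t" "ereal t < affinity_dim A"
    using ereal_dense2[OF q(2)] by (auto simp: s_def)
  obtain f :: "real^'d^'d \<Rightarrow> real" and D K where f: "submultiplicative f" "comparable (svf s) f"
    and DK: "D \<ge> 1" "K > 0"
    and spread: "\<And>(A :: real^'d^'d^'N) n. pressure A s < 0 \<Longrightarrow> n \<ge> 1 \<Longrightarrow>
       word_sum f A (D * n) \<le> K * word_sum f A n ^ (D - 1)"
    using negative_pressure_spread[OF s, where 'd = 'd and 'N = 'N] by blast
  have "\<not> pressure A t < 0" using affinity_dim_le[of t A] t s by (meson leD less_trans)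
  then obtain n where n: "n \<ge> 1" "K * word_sum f A n ^ (D - 1) < word_sum f A (D * n)"
    using spread_imp_pressure_neg[OF A s(1) t(1) f DK] by (meson not_less)
  define g where "g = (\<lambda>A :: real^'d^'d^'N. word_sum f A (D * n) - K * word_sum f A n ^ (D - 1))"
  have "continuous_on contraction_tuples g"
    unfolding g_def by (intro continuous_intros continuous_on_word_sum f)
  then have "(g \<longlongrightarrow> g A) (at A within contraction_tuples)"
    using A by (simp add: continuous_on_def)
  moreover have "0 < g A" using n by (simp add: g_def)
  ultimately have "\<forall>\<^sub>F A' in at A within contraction_tuples. 0 < g A'" by (rule order_tendstoD(1))
  moreover have "\<forall>\<^sub>F A' in at A within contraction_tuples. A' \<in> contraction_tuples"
    by (simp add: eventually_at_filter)
  ultimately show ?thesis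
  proof eventually_elim
    case (elim A')
    then have "\<not> pressure A' s < 0" using spread[of A' n] n(1) by (auto simp: g_def)
    then have "ereal s \<le> affinity_dim A'" using affinity_dim_ge elim s by blast
    then show ?case using q(1) by (simp add: s_def less_le_trans)
  qed
qed

theorem theorem2p3:
  fixes B :: "(real^'d^'d^'N) set"
  defines "B \<equiv> {A. \<forall>i. A $ i \<in> op_unit_ball}"
  shows "affinity_dim ` B \<subseteq> {0..<\<infinity>} \<and> continuous_on B affinity_dim"
proof
  have B: "B = contraction_tuples" by (simp add: B_def contraction_tuples_def)
  show "affinity_dim ` B \<subseteq> {0..<\<infinity>}"
  proof (rule image_subsetI)
    fix A assume "A \<in> B"
    then obtain s where "s > 0" "pressure A s < 0" using pressure_neg_exists[of A] B by auto
    then have "affinity_dim A \<le> ereal s" by (rule affinity_dim_le)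
    then have "affinity_dim A < \<infinity>" by (rule le_less_trans) simp
    then show "affinity_dim A \<in> {0..<\<infinity>}" by (simp add: affinity_dim_nonneg)
  qed
  show "continuous_on B affinity_dim"
    unfolding continuous_on_def B
    by (intro ballI order_tendstoI affinity_dim_upper_semicontinuous affinity_dim_lower_semicontinuous)
qed

end
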